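(* Let $n$ and $k$ be integers with $\lfloor n/2\rfloor+1\le k\le n-1$. For every $G\in G(n,k)$, $$\rho(G)\le\rho(\mathcal G(n,k)),$$ with equality if and only if $G\cong\mathcal G(n,k)$.
   Context: A clique tree is a connected graph each of whose blocks (maximal connected subgraphs without a cut vertex of their own) is a complete graph. $Z(\cdot)$ is the zero forcing number: with vertices coloured blue or white, a blue vertex with exactly one white neighbour turns that neighbour blue; $Z(G)$ is the minimum size of an initially blue set from which all vertices eventually become blue. $G(n,k)$ is the class of clique trees on $n$ vertices with zero forcing number $k$ in which every block has at least $3$ vertices. $\mathcal G(n,k)$ is the clique tree consisting of one copy of $K_{2k-n+2}$ and $n-k-1$ copies of $K_3$, all sharing a single common vertex (and otherwise disjoint); it lies in $G(n,k)$. $\rho(\cdot)$ is the spectral radius of the adjacency matrix. *)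

theory Defs
  imports Main "Jordan_Normal_Form.Spectral_Radius"
begin

definition simple_graph :: "nat \<Rightarrow> (nat \<Rightarrow> nat \<Rightarrow> bool) \<Rightarrow> bool" where
  "simple_graph n E \<longleftrightarrow> (\<forall>x y. E x y \<longrightarrow> x < n \<and> y < n \<and> x \<noteq> y \<and> E y x)"

text \<open>The induced subgraph on S is connected (empty set counts as connected).\<close>
definition connected_on :: "(nat \<Rightarrow> nat \<Rightarrow> bool) \<Rightarrow> nat set \<Rightarrow> bool" where
  "connected_on E S \<longleftrightarrow>
     (\<forall>x\<in>S. \<forall>y\<in>S. (\<lambda>u v. E u v \<and> u \<in> S \<and> v \<in> S)\<^sup>*\<^sup>* x y)"

definition nonseparable :: "(nat \<Rightarrow> nat \<Rightarrow> bool) \<Rightarrow> nat set \<Rightarrow> bool" where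
  "nonseparable E S \<longleftrightarrow> connected_on E S \<and> (\<forall>v\<in>S. connected_on E (S - {v}))"

definition is_block :: "nat \<Rightarrow> (nat \<Rightarrow> nat \<Rightarrow> bool) \<Rightarrow> nat set \<Rightarrow> bool" where
  "is_block n E B \<longleftrightarrow> B \<noteq> {} \<and> B \<subseteq> {0..<n} \<and> nonseparable E B \<and>
     (\<forall>B'. B \<subset> B' \<and> B' \<subseteq> {0..<n} \<longrightarrow> \<not> nonseparable E B')"

definition clique_tree :: "nat \<Rightarrow> (nat \<Rightarrow> nat \<Rightarrow> bool) \<Rightarrow> bool" where
  "clique_tree n E \<longleftrightarrow> simple_graph n E \<and> connected_on E {0..<n} \<and>
     (\<forall>B. is_block n E B \<longrightarrow> (\<forall>x\<in>B. \<forall>y\<in>B. x \<noteq> y \<longrightarrow> E x y))"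

inductive zf_blue :: "(nat \<Rightarrow> nat \<Rightarrow> bool) \<Rightarrow> nat set \<Rightarrow> nat \<Rightarrow> bool"
  for E :: "nat \<Rightarrow> nat \<Rightarrow> bool" and S :: "nat set" where
  init: "v \<in> S \<Longrightarrow> zf_blue E S v"
| force: "zf_blue E S u \<Longrightarrow> E u v \<Longrightarrow> (\<forall>w. E u w \<and> w \<noteq> v \<longrightarrow> zf_blue E S w)
          \<Longrightarrow> zf_blue E S v"

definition zero_forcing_set :: "nat \<Rightarrow> (nat \<Rightarrow> nat \<Rightarrow> bool) \<Rightarrow> nat set \<Rightarrow> bool" where
  "zero_forcing_set n E S \<longleftrightarrow> S \<subseteq> {0..<n} \<and> (\<forall>v<n. zf_blue E S v)"

definition zero_forcing_number :: "nat \<Rightarrow> (nat \<Rightarrow> nat \<Rightarrow> bool) \<Rightarrow> nat" where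
  "zero_forcing_number n E = (LEAST k. \<exists>S. zero_forcing_set n E S \<and> card S = k)"

definition Gclass :: "nat \<Rightarrow> nat \<Rightarrow> (nat \<Rightarrow> nat \<Rightarrow> bool) set" where
  "Gclass n k = {E. clique_tree n E \<and> zero_forcing_number n E = k \<and>
                   (\<forall>B. is_block n E B \<longrightarrow> card B \<ge> 3)}"

definition adj_matrix :: "nat \<Rightarrow> (nat \<Rightarrow> nat \<Rightarrow> bool) \<Rightarrow> complex mat" where
  "adj_matrix n E = mat n n (\<lambda>(i, j). if E i j then 1 else 0)"

definition graph_iso :: "nat \<Rightarrow> (nat \<Rightarrow> nat \<Rightarrow> bool) \<Rightarrow> (nat \<Rightarrow> nat \<Rightarrow> bool) \<Rightarrow> bool" where
  "graph_iso n E E' \<longleftrightarrow> (\<exists>f. bij_betw f {0..<n} {0..<n} \<and>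
      (\<forall>x<n. \<forall>y<n. E x y \<longleftrightarrow> E' (f x) (f y)))"

text \<open>The extremal graph: K_m on {0..<m} with m = 2k-n+2, and n-k-1 triangles
  {0, m+2i, m+2i+1} (i < n-k-1), all sharing vertex 0.\<close>
definition extremal_graph :: "nat \<Rightarrow> nat \<Rightarrow> nat \<Rightarrow> nat \<Rightarrow> bool" where
  "extremal_graph n k x y \<longleftrightarrow>
     (let m = 2 * k + 2 - n in
      x < n \<and> y < n \<and> x \<noteq> y \<and>
      ((x < m \<and> y < m) \<or> (x = 0 \<and> m \<le> y) \<or> (y = 0 \<and> m \<le> x) \<or>
       (m \<le> x \<and> m \<le> y \<and> (x - m) div 2 = (y - m) div 2)))"

end

theory Submission
  imports Defs "HOL-Library.Transitive_Closure_Table"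
begin

text \<open>
  A force inside a block turns the whole block blue, so each block carries at most one force and
  \<open>G\<close> has at least \<open>n - k\<close> blocks. Let \<open>w\<close> be the entrywise modulus of an eigenvector for
  \<open>\<rho>(G)\<close> and root \<open>G\<close> at a vertex \<open>r\<close> maximising \<open>w\<close>. Sliding the top vertex of every block to
  \<open>r\<close> does not decrease the quadratic form of \<open>w\<close> and produces a cone over disjoint cliques of sizes
  \<open>c\<^sub>i \<ge> 2\<close> with sum \<open>n - 1\<close>. The form of such a cone is at most \<open>\<lambda> \<parallel>w\<parallel>\<^sup>2\<close> as soon as
  \<open>\<Sum> c\<^sub>i / (\<lambda> + 1 - c\<^sub>i) \<le> \<lambda>\<close>, and by convexity the left side is largest when all \<open>c\<^sub>i\<close> but one are
  \<open>2\<close>, the sizes of the extremal graph. Equality at every step forces these sizes and a common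
  vertex of all blocks.
\<close>

section \<open>Spectral radius and quadratic form\<close>

text \<open>Eigenvectors become plain functions on indices, so that all later work is with finite
  sums instead of matrices.\<close>

lemma eigenvalue_adj_matrix:
  fixes a :: complex
  shows "eigenvalue (adj_matrix n E) a \<longleftrightarrow>
     (\<exists>z. (\<exists>i<n. z i \<noteq> 0) \<and> (\<forall>i<n. (\<Sum>j<n. if E i j then z j else 0) = a * z i))"
    (is "_ \<longleftrightarrow> ?R")
proof
  assume "eigenvalue (adj_matrix n E) a"
  then obtain v where v: "v \<in> carrier_vec n" "v \<noteq> 0\<^sub>v n" "adj_matrix n E *\<^sub>v v = a \<cdot>\<^sub>v v"
    unfolding eigenvalue_def eigenvector_def by (auto simp: adj_matrix_def)
  have "\<exists>i<n. v $ i \<noteq> 0" using v(1,2) by (metis carrier_vecD eq_vecI index_zero_vec(1) index_zero_vec(2))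
  moreover have "(\<Sum>j<n. if E i j then v $ j else 0) = a * v $ i" if "i < n" for i
  proof -
    have "(adj_matrix n E *\<^sub>v v) $ i = a * v $ i" using v that by simp
    moreover have "(adj_matrix n E *\<^sub>v v) $ i = (\<Sum>j<n. (if E i j then 1 else 0) * v $ j)"
      using that v(1) by (auto simp: adj_matrix_def scalar_prod_def atLeast0LessThan intro!: sum.cong)
    moreover have "\<dots> = (\<Sum>j<n. if E i j then v $ j else 0)" by (rule sum.cong) auto
    ultimately show ?thesis by simp
  qed
  ultimately show ?R by (intro exI[of _ "\<lambda>i. v $ i"]) blast
next
  assume ?R
  then obtain z where z: "\<exists>i<n. z i \<noteq> 0"
    "\<And>i. i < n \<Longrightarrow> (\<Sum>j<n. if E i j then z j else 0) = a * z i" by blast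
  define v where "v = vec n z"
  have "v \<noteq> 0\<^sub>v n" using z(1) unfolding v_def by (metis index_vec index_zero_vec(1))
  moreover have "adj_matrix n E *\<^sub>v v = a \<cdot>\<^sub>v v"
  proof (rule eq_vecI)
    fix i assume "i < dim_vec (a \<cdot>\<^sub>v v)"
    then have i: "i < n" by (simp add: v_def)
    then have "(adj_matrix n E *\<^sub>v v) $ i = (\<Sum>j<n. (if E i j then 1 else 0) * z j)"
      by (auto simp: adj_matrix_def v_def scalar_prod_def atLeast0LessThan intro!: sum.cong)
    also have "\<dots> = (\<Sum>j<n. if E i j then z j else 0)" by (rule sum.cong) auto
    finally show "(adj_matrix n E *\<^sub>v v) $ i = (a \<cdot>\<^sub>v v) $ i" using z(2) i by (simp add: v_def)
  qed (simp add: v_def adj_matrix_def)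
  ultimately show "eigenvalue (adj_matrix n E) a"
    unfolding eigenvalue_def eigenvector_def by (intro exI[of _ v]) (auto simp: v_def adj_matrix_def)
qed

lemma adj_matrix_carrier [simp]: "adj_matrix n E \<in> carrier_mat n n"
  by (simp add: adj_matrix_def)

lemma norm_eigenvalue_le_spectral_radius:
  fixes a :: complex
  assumes "0 < n" "\<exists>i<n. z i \<noteq> 0"
    "\<And>i. i < n \<Longrightarrow> (\<Sum>j<n. if E i j then z j else 0) = a * z i"
  shows "norm a \<le> spectral_radius (adj_matrix n E)"
proof (rule spectral_radius_mem_max(2)[of _ n])
  show "norm a \<in> norm ` spectrum (adj_matrix n E)"
    using assms eigenvalue_adj_matrix[of n E a] unfolding spectrum_def by blast
qed (use assms in auto)

lemma spectral_radius_eigenvector: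
  assumes "0 < n"
  obtains a :: complex and z where "norm a = spectral_radius (adj_matrix n E)" "\<exists>i<n. z i \<noteq> 0"
    "\<And>i. i < n \<Longrightarrow> (\<Sum>j<n. if E i j then z j else 0) = a * z i"
proof -
  have "spectral_radius (adj_matrix n E) \<in> norm ` spectrum (adj_matrix n E)"
    using assms by (intro spectral_radius_mem_max(1)[of _ n]) auto
  then show ?thesis
    using that eigenvalue_adj_matrix[of n E] unfolding spectrum_def by (smt (verit) imageE mem_Collect_eq)
qed

text \<open>Taking entrywise moduli of an eigenvector replaces the Perron vector.\<close>
lemma spectral_radius_nonneg_vector:
  assumes "0 < n"
  obtains w :: "nat \<Rightarrow> real" where "\<And>i. 0 \<le> w i" "\<exists>i<n. 0 < w i"
    "spectral_radius (adj_matrix n E) * (\<Sum>i<n. (w i)\<^sup>2)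
      \<le> (\<Sum>i<n. \<Sum>j<n. if E i j then w i * w j else 0)"
proof -
  let ?r = "spectral_radius (adj_matrix n E)"
  obtain a :: complex and z where az: "norm a = ?r" "\<exists>i<n. z i \<noteq> 0"
    "\<And>i. i < n \<Longrightarrow> (\<Sum>j<n. if E i j then z j else 0) = a * z i"
    using spectral_radius_eigenvector[OF assms, of E] by blast
  define w where "w i = norm (z i)" for i
  \<comment> \<open>The triangle inequality in each row of the eigenvector equation; an inequality
    for the moduli is enough to bound the quadratic form from below.\<close>
  have row: "?r * w i \<le> (\<Sum>j<n. if E i j then w j else 0)" if "i < n" for i
  proof -
    have "?r * w i = norm (\<Sum>j<n. if E i j then z j else 0)"
      by (simp add: az(3)[OF that] norm_mult az(1) w_def)
    also have "\<dots> \<le> (\<Sum>j<n. norm (if E i j then z j else 0))" by (rule norm_sum)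
    also have "\<dots> = (\<Sum>j<n. if E i j then w j else 0)" by (rule sum.cong) (auto simp: w_def)
    finally show ?thesis .
  qed
  have "?r * (\<Sum>i<n. (w i)\<^sup>2) = (\<Sum>i<n. w i * (?r * w i))"
    by (simp add: sum_distrib_left power2_eq_square algebra_simps)
  also have "\<dots> \<le> (\<Sum>i<n. w i * (\<Sum>j<n. if E i j then w j else 0))"
    by (intro sum_mono mult_left_mono row) (auto simp: w_def)
  also have "\<dots> = (\<Sum>i<n. \<Sum>j<n. if E i j then w i * w j else 0)"
    by (auto simp: sum_distrib_left intro!: sum.cong)
  finally show ?thesis using az(2) by (intro that[of w]) (auto simp: w_def)
qed

text \<open>An eigenvector of \<open>E'\<close> composed with the isomorphism is an eigenvector of
  \<open>E\<close> for the same eigenvalue. One direction is enough: the reverse inequality is the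
  extremal bound itself.\<close>

lemma graph_iso_spectral_radius_le:
  assumes "0 < n" "graph_iso n E E'"
  shows "spectral_radius (adj_matrix n E') \<le> spectral_radius (adj_matrix n E)"
proof -
  obtain f where f: "bij_betw f {0..<n} {0..<n}" "\<forall>x<n. \<forall>y<n. E x y \<longleftrightarrow> E' (f x) (f y)"
    using assms(2) unfolding graph_iso_def by blast
  then have f': "bij_betw f {..<n} {..<n}" by (simp add: atLeast0LessThan)
  obtain a :: complex and z where az: "norm a = spectral_radius (adj_matrix n E')" "\<exists>i<n. z i \<noteq> 0"
    "\<And>i. i < n \<Longrightarrow> (\<Sum>j<n. if E' i j then z j else 0) = a * z i"
    using spectral_radius_eigenvector[OF assms(1), of E'] by blast
  have fn: "f i < n" if "i < n" for i using f' that by (auto dest: bij_betwE)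
  have "norm a \<le> spectral_radius (adj_matrix n E)"
  proof (rule norm_eigenvalue_le_spectral_radius[OF assms(1), of "z \<circ> f"])
    show "\<exists>i<n. (z \<circ> f) i \<noteq> 0"
      using az(2) f' by (metis bij_betw_def comp_apply imageE lessThan_iff)
    fix i assume i: "i < n"
    have "(\<Sum>j<n. if E i j then (z \<circ> f) j else 0) = (\<Sum>j<n. if E' (f i) (f j) then z (f j) else 0)"
      using f(2) i by (intro sum.cong) auto
    also have "\<dots> = (\<Sum>j<n. if E' (f i) j then z j else 0)"
      by (rule sum.reindex_bij_betw[OF f'])
    finally show "(\<Sum>j<n. if E i j then (z \<circ> f) j else 0) = a * (z \<circ> f) i"
      using az(3)[OF fn[OF i]] by simp
  qed
  then show ?thesis using az(1) by simp
qed

section \<open>Blocks\<close>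

text \<open>The relation inside \<open>connected_on\<close>, named so that facts about its closure
  can be reused for varying vertex sets.\<close>

definition edge_in :: "(nat \<Rightarrow> nat \<Rightarrow> bool) \<Rightarrow> nat set \<Rightarrow> nat \<Rightarrow> nat \<Rightarrow> bool" where
  "edge_in E S u v \<longleftrightarrow> E u v \<and> u \<in> S \<and> v \<in> S"

lemma connected_on_iff: "connected_on E S \<longleftrightarrow> (\<forall>x\<in>S. \<forall>y\<in>S. (edge_in E S)\<^sup>*\<^sup>* x y)"
  by (simp add: connected_on_def edge_in_def[abs_def])

lemma edge_in_mono: "(edge_in E S)\<^sup>*\<^sup>* x y \<Longrightarrow> S \<subseteq> T \<Longrightarrow> (edge_in E T)\<^sup>*\<^sup>* x y"
  by (erule rtranclp_mono[THEN predicate2D, rotated]) (auto simp: edge_in_def)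

lemma edge_in_sym:
  assumes "\<And>x y. E x y \<Longrightarrow> E y x" "(edge_in E S)\<^sup>*\<^sup>* x y"
  shows "(edge_in E S)\<^sup>*\<^sup>* y x"
  using assms(2)
proof (induction rule: rtranclp_induct)
  case (step y z)
  then have "edge_in E S z y" using assms(1) by (simp add: edge_in_def)
  then show ?case using step.IH by (rule converse_rtranclp_into_rtranclp)
qed simp

lemma edge_in_target: "(edge_in E S)\<^sup>*\<^sup>* x y \<Longrightarrow> x \<in> S \<Longrightarrow> y \<in> S"
  by (erule rtranclp.cases) (auto simp: edge_in_def)

lemma connected_on_hub:
  assumes "\<And>x y. E x y \<Longrightarrow> E y x" "\<And>u. u \<in> S \<Longrightarrow> (edge_in E S)\<^sup>*\<^sup>* u h"
  shows "connected_on E S"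
  unfolding connected_on_iff
  by (meson assms rtranclp_trans edge_in_sym)

lemma connected_on_Un:
  assumes "connected_on E A" "connected_on E B" "A \<inter> B \<noteq> {}"
  shows "connected_on E (A \<union> B)"
proof -
  obtain z where z: "z \<in> A" "z \<in> B" using assms(3) by blast
  have "(edge_in E (A \<union> B))\<^sup>*\<^sup>* x z \<and> (edge_in E (A \<union> B))\<^sup>*\<^sup>* z x" if "x \<in> A \<union> B" for x
  proof (cases "x \<in> A")
    case True
    then show ?thesis using assms(1) z unfolding connected_on_iff
      by (meson Un_upper1 edge_in_mono)
  next
    case False
    then show ?thesis using assms(2) z that unfolding connected_on_iff
      by (meson Un_iff Un_upper2 edge_in_mono)
  qed
  then show ?thesis unfolding connected_on_iff by (meson rtranclp_trans)
qed

lemma nonseparable_Diff: "nonseparable E A \<Longrightarrow> connected_on E (A - {v})"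
  by (cases "v \<in> A") (auto simp: nonseparable_def)

text \<open>Deleting one vertex leaves at least one of \<open>x\<close> and \<open>y\<close>, and
  the two remainders stay connected through it.\<close>

lemma nonseparable_Un:
  assumes "nonseparable E A" "nonseparable E B" "x \<in> A \<inter> B" "y \<in> A \<inter> B" "x \<noteq> y"
  shows "nonseparable E (A \<union> B)"
  unfolding nonseparable_def
proof (intro conjI ballI)
  show "connected_on E (A \<union> B)"
    using assms by (intro connected_on_Un) (auto simp: nonseparable_def)
  fix v
  have "connected_on E ((A - {v}) \<union> (B - {v}))"
    using assms by (intro connected_on_Un nonseparable_Diff) auto
  then show "connected_on E (A \<union> B - {v})" by (simp add: Un_Diff)
qed

lemma nonseparable_edge:
  assumes "\<And>x y. E x y \<Longrightarrow> E y x" "E u v"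
  shows "nonseparable E {u, v}"
  unfolding nonseparable_def
proof (intro conjI ballI)
  show "connected_on E {u, v}"
  proof (rule connected_on_hub[OF assms(1), where h = v])
    have "edge_in E {u, v} u v" using assms by (simp add: edge_in_def)
    then show "(edge_in E {u, v})\<^sup>*\<^sup>* x v" if "x \<in> {u, v}" for x using that by auto
  qed
  fix w assume "w \<in> {u, v}"
  then have "{u, v} - {w} = {} \<or> {u, v} - {w} = {u} \<or> {u, v} - {w} = {v}" by auto
  then show "connected_on E ({u, v} - {w})" by (elim disjE) (simp_all add: connected_on_iff)
qed

lemma rtranclp_edge_in_rtrancl_path:
  assumes "rtrancl_path R x xs y"
  shows "u \<in> set (x # xs) \<Longrightarrow> (edge_in R (set (x # xs)))\<^sup>*\<^sup>* u y"
  using assms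
proof (induction arbitrary: u rule: rtrancl_path.induct)
  case (step x y ys z)
  show ?case
  proof (cases "u = x")
    case True
    have "edge_in R (set (x # y # ys)) x y" using step by (auto simp: edge_in_def)
    moreover have "(edge_in R (set (x # y # ys)))\<^sup>*\<^sup>* y z"
      by (rule edge_in_mono[OF step.IH]) auto
    ultimately show ?thesis using True by (meson converse_rtranclp_into_rtranclp)
  next
    case False
    then have "u \<in> set (y # ys)" using step.prems by auto
    then show ?thesis by (intro edge_in_mono[OF step.IH]) auto
  qed
qed simp

text \<open>A deleted vertex cuts a path into at most two segments, and each of them still contains
  an end of the path. This is what shows that a cycle has no cut vertex.\<close>

lemma distinct_path_remove_vertex:
  assumes "rtrancl_path R x xs y" "\<And>x y. R x y \<Longrightarrow> R y x" "distinct (x # xs)"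
  shows "u \<in> set (x # xs) - {c} \<Longrightarrow>
    (edge_in R (set (x # xs) - {c}))\<^sup>*\<^sup>* u x \<or> (edge_in R (set (x # xs) - {c}))\<^sup>*\<^sup>* u y"
  using assms
proof (induction arbitrary: u rule: rtrancl_path.induct)
  case (step x y ys z)
  show ?case
  proof (cases "u = x")
    case False
    then have u: "u \<in> set (y # ys) - {c}" using step.prems by auto
    show ?thesis
    proof (cases "c = x")
      case True
      \<comment> \<open>By distinctness the whole tail survives the deletion of the first vertex and
        leads to \<open>z\<close>.\<close>
      have "(edge_in R (set (y # ys)))\<^sup>*\<^sup>* u z"
        by (rule rtranclp_edge_in_rtrancl_path) (use u step in auto)
      moreover have "set (y # ys) \<subseteq> set (x # y # ys) - {c}" using True step.prems by auto
      ultimately show ?thesis by (meson edge_in_mono)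
    next
      case c: False
      have sub: "set (y # ys) - {c} \<subseteq> set (x # y # ys) - {c}" by auto
      have "(edge_in R (set (y # ys) - {c}))\<^sup>*\<^sup>* u y \<or> (edge_in R (set (y # ys) - {c}))\<^sup>*\<^sup>* u z"
        using step u by auto
      then show ?thesis
      proof
        assume a: "(edge_in R (set (y # ys) - {c}))\<^sup>*\<^sup>* u y"
        \<comment> \<open>The walk ends inside the set without \<open>c\<close>, so \<open>y\<close>
          survives and the walk extends by the edge back to \<open>x\<close>.\<close>
        then have "y \<noteq> c" using u edge_in_target by fastforce
        then have "edge_in R (set (x # y # ys) - {c}) y x" using step c by (auto simp: edge_in_def)
        moreover have "(edge_in R (set (x # y # ys) - {c}))\<^sup>*\<^sup>* u y" using a sub by (rule edge_in_mono)
        ultimately show ?thesis by (meson rtranclp.rtrancl_into_rtrancl)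
      qed (use edge_in_mono[OF _ sub] in blast)
    qed
  qed auto
qed auto

text \<open>A path from \<open>a\<close> to \<open>b\<close> avoiding \<open>v\<close> closes up
  through \<open>v\<close> to a cycle, which has no cut vertex. For \<open>a = b\<close> the cycle
  degenerates to the edge \<open>{v, a}\<close>, whose end \<open>a\<close> need not lie in
  \<open>V\<close>; hence the form of the bound on \<open>C\<close>.\<close>

lemma nonseparable_cycle:
  assumes sym: "\<And>x y. E x y \<Longrightarrow> E y x" and va: "E v a" and vb: "E v b" and ab: "a \<noteq> v"
    and path: "(edge_in E (V - {v}))\<^sup>*\<^sup>* a b"
  obtains C where "nonseparable E C" "v \<in> C" "a \<in> C" "b \<in> C" "C \<subseteq> V \<union> {v, a}"
proof -
  obtain xs' where "rtrancl_path (edge_in E (V - {v})) a xs' b"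
    using path rtranclp_eq_rtrancl_path by metis
  then obtain xs where xs: "rtrancl_path (edge_in E (V - {v})) a xs b" "distinct (a # xs)"
    by (meson rtrancl_path_distinct)
  define C where "C = set (a # xs)"
  have sub: "set xs \<subseteq> V - {v}"
    using xs(1) by (induction rule: rtrancl_path.induct) (auto simp: edge_in_def)
  have vC: "v \<notin> C" using sub ab unfolding C_def by auto
  have p: "rtrancl_path E a xs b" using xs(1) by (rule rtrancl_path_mono) (auto simp: edge_in_def)
  have bC: "b \<in> C" using p unfolding C_def by (induction rule: rtrancl_path.induct) auto
  have aC: "a \<in> C" by (simp add: C_def)
  \<comment> \<open>After the deletion of \<open>c\<close>, every path vertex still reaches a
    surviving end \<open>a\<close> or \<open>b\<close>, and both ends are adjacent to
    \<open>v\<close>.\<close>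
  have hub: "connected_on E (insert v C - {c})" if "c \<noteq> v" for c
  proof (rule connected_on_hub[OF sym, where h = v])
    fix u assume u: "u \<in> insert v C - {c}"
    show "(edge_in E (insert v C - {c}))\<^sup>*\<^sup>* u v"
    proof (cases "u = v")
      case False
      then have uC: "u \<in> C - {c}" using u by auto
      have sb: "C - {c} \<subseteq> insert v C - {c}" by auto
      obtain x where x: "x = a \<or> x = b" "(edge_in E (C - {c}))\<^sup>*\<^sup>* u x"
        using distinct_path_remove_vertex[OF p sym xs(2)] uC unfolding C_def by blast
      from x(2) have "x \<noteq> c" using uC edge_in_target by fastforce
      then have "edge_in E (insert v C - {c}) x v" using x(1) va vb sym aC bC that by (auto simp: edge_in_def)
      moreover have "(edge_in E (insert v C - {c}))\<^sup>*\<^sup>* u x" using x(2) sb by (rule edge_in_mono)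
      ultimately show ?thesis by (meson rtranclp.rtrancl_into_rtrancl)
    qed simp
  qed
  have "connected_on E C"
    unfolding C_def by (rule connected_on_hub[OF sym, OF _ rtranclp_edge_in_rtrancl_path[OF p]])
  moreover have "connected_on E (insert v C)"
  proof (rule connected_on_hub[OF sym, where h = v])
    fix u assume u: "u \<in> insert v C"
    have "edge_in E (insert v C) a v" using va sym aC by (auto simp: edge_in_def)
    moreover have "(edge_in E (insert v C))\<^sup>*\<^sup>* u a" if "u \<noteq> v"
      using that u \<open>connected_on E C\<close> aC unfolding connected_on_iff by (meson insertE subset_insertI edge_in_mono)
    ultimately show "(edge_in E (insert v C))\<^sup>*\<^sup>* u v"
      by (metis rtranclp.rtrancl_into_rtrancl rtranclp.rtrancl_refl)
  qed
  ultimately have "nonseparable E (insert v C)"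
    unfolding nonseparable_def using hub vC by (metis Diff_insert_absorb)
  then show ?thesis using that[of "insert v C"] aC bC sub unfolding C_def by auto
qed

lemma finite_blocks: "finite {B. is_block n E B}"
  by (rule finite_subset[of _ "Pow {0..<n}"]) (auto simp: is_block_def)

lemma nonseparable_subset_block:
  assumes "nonseparable E A" "A \<noteq> {}" "A \<subseteq> {0..<n}"
  obtains B where "is_block n E B" "A \<subseteq> B"
proof -
  define F where "F = {B. B \<subseteq> {0..<n} \<and> nonseparable E B}"
  have "finite F" unfolding F_def by (rule finite_subset[of _ "Pow {0..<n}"]) auto
  then have "\<exists>B\<in>F. A \<subseteq> B \<and> (\<forall>B'\<in>F. B \<subseteq> B' \<longrightarrow> B = B')"
    by (rule finite_has_maximal2) (simp add: F_def assms)
  then obtain B where B: "B \<in> F" "A \<subseteq> B" "\<And>B'. B' \<in> F \<Longrightarrow> B \<subseteq> B' \<Longrightarrow> B = B'" by auto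
  have "is_block n E B"
    unfolding is_block_def
  proof (intro conjI allI impI)
    show "B \<noteq> {}" using B(2) assms(2) by auto
    show "B \<subseteq> {0..<n}" "nonseparable E B" using B(1) by (auto simp: F_def)
    fix B' assume B': "B \<subset> B' \<and> B' \<subseteq> {0..<n}"
    then show "\<not> nonseparable E B'" using B(3)[of B'] by (auto simp: F_def)
  qed
  then show ?thesis using B(2) by (rule that)
qed

lemma block_maximal: "is_block n E B \<Longrightarrow> nonseparable E C \<Longrightarrow> C \<subseteq> {0..<n} \<Longrightarrow> B \<subseteq> C \<Longrightarrow> B = C"
  by (auto simp: is_block_def psubset_eq)

text \<open>Two common vertices make the union nonseparable, and maximality identifies both blocks
  with it.\<close>

lemma block_eqI:
  assumes "is_block n E A" "is_block n E B" "x \<in> A" "x \<in> B" "y \<in> A" "y \<in> B" "x \<noteq> y"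
  shows "A = B"
proof -
  have N: "nonseparable E (A \<union> B)"
    by (rule nonseparable_Un[of E A B x y]) (use assms in \<open>auto simp: is_block_def\<close>)
  have V: "A \<union> B \<subseteq> {0..<n}" using assms(1,2) by (simp add: is_block_def)
  have "A = A \<union> B" using assms(1) N V by (rule block_maximal) simp
  moreover have "B = A \<union> B" using assms(2) N V by (rule block_maximal) simp
  ultimately show ?thesis by simp
qed

lemma edge_block:
  assumes "simple_graph n E" "E u v"
  obtains B where "is_block n E B" "u \<in> B" "v \<in> B"
proof -
  have "nonseparable E {u, v}" using assms by (intro nonseparable_edge) (auto simp: simple_graph_def)
  moreover have "{u, v} \<subseteq> {0..<n}" using assms by (auto simp: simple_graph_def)
  ultimately obtain B where "is_block n E B" "{u, v} \<subseteq> B" using nonseparable_subset_block[of E "{u, v}" n] by auto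
  then show ?thesis using that[of B] by simp
qed

text \<open>An edge is a nonseparable pair and so extends to a block; conversely blocks are cliques.
  The graph is thereby determined by its blocks.\<close>

lemma clique_tree_edge_iff:
  assumes "clique_tree n E"
  shows "E u v \<longleftrightarrow> u \<noteq> v \<and> (\<exists>B. is_block n E B \<and> u \<in> B \<and> v \<in> B)"
proof
  assume e: "E u v"
  have sg: "simple_graph n E" using assms by (simp add: clique_tree_def)
  obtain B where "is_block n E B" "u \<in> B" "v \<in> B" by (rule edge_block[OF sg e])
  moreover have "u \<noteq> v" using sg e by (auto simp: simple_graph_def)
  ultimately show "u \<noteq> v \<and> (\<exists>B. is_block n E B \<and> u \<in> B \<and> v \<in> B)" by blast
next
  assume "u \<noteq> v \<and> (\<exists>B. is_block n E B \<and> u \<in> B \<and> v \<in> B)"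
  then show "E u v" using assms by (auto simp: clique_tree_def)
qed

section \<open>Zero forcing and the number of blocks\<close>

text \<open>Each force is charged to the block of its edge: when \<open>u\<close> forces
  \<open>v\<close>, the rest of that clique is already blue, so the block becomes entirely blue with
  \<open>v\<close>. As \<open>zf_blue\<close> records no order of forces, a set \<open>T\<close>
  maximal for the counting invariant \<open>P\<close> takes the place of a chronological
  list.\<close>

lemma zero_forcing_set_card:
  assumes ct: "clique_tree n E" and zf: "zero_forcing_set n E S"
  shows "n \<le> card S + card {B. is_block n E B}"
proof -
  define P where "P T \<longleftrightarrow> S \<subseteq> T \<and> T \<subseteq> {0..<n} \<and>
    card T \<le> card S + card {B. is_block n E B \<and> B \<subseteq> T}" for T
  have sg: "simple_graph n E" using ct by (simp add: clique_tree_def)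
  have S: "P S" using zf by (auto simp: zero_forcing_set_def P_def)
  have "Collect P \<subseteq> Pow {0..<n}" by (auto simp: P_def subset_iff)
  then have "finite (Collect P)" by (rule finite_subset) simp
  then have "\<exists>T\<in>Collect P. S \<subseteq> T \<and> (\<forall>T'\<in>Collect P. T \<subseteq> T' \<longrightarrow> T = T')"
    by (rule finite_has_maximal2) (simp add: S)
  then obtain T where "T \<in> Collect P" and max: "\<forall>T'\<in>Collect P. T \<subseteq> T' \<longrightarrow> T = T'" by blast
  then have PT: "P T" by simp
  have T_max: "T = T'" if "P T'" "T \<subseteq> T'" for T'
    using max that by (simp add: Ball_def)
  have T: "S \<subseteq> T" "T \<subseteq> {0..<n}" "card T \<le> card S + card {B. is_block n E B \<and> B \<subseteq> T}"
    using PT unfolding P_def by auto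
  have "x \<in> T" if "zf_blue E S x" for x
    using that
  proof (induction rule: zf_blue.induct)
    case (force u v)
    show ?case
    proof (rule ccontr)
      assume v: "v \<notin> T"
      obtain B where B: "is_block n E B" "u \<in> B" "v \<in> B" by (rule edge_block[OF sg force(2)])
      \<comment> \<open>\<open>u\<close> is in \<open>T\<close>, and the other vertices of the
        clique \<open>B\<close> are neighbours of \<open>u\<close>, hence in \<open>T\<close> unless
        equal to \<open>v\<close>.\<close>
      have "B \<subseteq> insert v T"
      proof
        fix w assume "w \<in> B"
        then have "w = u \<or> E u w" using B clique_tree_edge_iff[OF ct] by blast
        then show "w \<in> insert v T" using force.IH by blast
      qed
      let ?D = "{B. is_block n E B \<and> B \<subseteq> T}"
      have fin: "finite {B. is_block n E B \<and> B \<subseteq> X}" for X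
        by (rule finite_subset[OF _ finite_blocks[of n E]]) auto
      \<comment> \<open>Adding \<open>v\<close> costs one vertex and completes the block
        \<open>B\<close>, so \<open>P\<close> persists, against the maximality of
        \<open>T\<close>.\<close>
      have "insert B ?D \<subseteq> {B. is_block n E B \<and> B \<subseteq> insert v T}" "B \<notin> ?D"
        using B v \<open>B \<subseteq> insert v T\<close> by auto
      then have "Suc (card ?D) \<le> card {B. is_block n E B \<and> B \<subseteq> insert v T}"
        using card_mono[OF fin[of "insert v T"], of "insert B ?D"] card_insert_disjoint[OF fin[of T], of B]
        by simp
      moreover have "card (insert v T) = Suc (card T)"
        using v finite_subset[OF T(2)] by auto
      moreover have "v < n" using sg force(2) by (auto simp: simple_graph_def)
      ultimately have "P (insert v T)" using T unfolding P_def by auto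
      then show False using T_max[of "insert v T"] v by auto
    qed
  qed (use T(1) in auto)
  then have "T = {0..<n}" using zf T(2) by (auto simp: zero_forcing_set_def)
  then have "n \<le> card S + card {B. is_block n E B \<and> B \<subseteq> {0..<n}}" using T(3) by simp
  moreover have "{B. is_block n E B \<and> B \<subseteq> {0..<n}} = {B. is_block n E B}" by (auto simp: is_block_def)
  ultimately show ?thesis by simp
qed

lemma zero_forcing_number_ge:
  assumes "clique_tree n E"
  shows "n \<le> zero_forcing_number n E + card {B. is_block n E B}"
proof -
  \<comment> \<open>The whole vertex set is forcing, so the \<open>LEAST\<close> is
    attained.\<close>
  have "zero_forcing_set n E {0..<n}" by (auto simp: zero_forcing_set_def intro: zf_blue.init)
  then have "\<exists>k S. zero_forcing_set n E S \<and> card S = k" by blast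
  then have "\<exists>S. zero_forcing_set n E S \<and> card S = zero_forcing_number n E"
    unfolding zero_forcing_number_def by (rule LeastI_ex)
  then show ?thesis using zero_forcing_set_card[OF assms] by metis
qed

section \<open>Rooting the blocks at a vertex\<close>

text \<open>Distance from \<open>r\<close>. The least exponent is meaningful only for reachable
  \<open>v\<close>, hence the reachability assumption in \<open>depth_parent\<close>.\<close>

definition depth :: "(nat \<Rightarrow> nat \<Rightarrow> bool) \<Rightarrow> nat \<Rightarrow> nat \<Rightarrow> nat" where
  "depth E r v = (LEAST j. (E ^^ j) r v)"

lemma depth_parent:
  assumes "E\<^sup>*\<^sup>* r v" "v \<noteq> r"
  obtains u where "E u v" "E\<^sup>*\<^sup>* r u" "depth E r u < depth E r v"
proof -
  have "\<exists>j. (E ^^ j) r v" using assms(1) by (simp add: rtranclp_power)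
  then have d: "(E ^^ depth E r v) r v" unfolding depth_def by (rule LeastI_ex)
  then obtain j where j: "depth E r v = Suc j" using assms(2) by (cases "depth E r v") auto
  then obtain u where u: "(E ^^ j) r u" "E u v" using d by auto
  then have "depth E r u \<le> j" unfolding depth_def by (intro Least_le)
  moreover have "E\<^sup>*\<^sup>* r u" using u(1) by (auto simp: rtranclp_power)
  ultimately show ?thesis using that u j by auto
qed

text \<open>\<open>p B\<close> is the vertex of \<open>B\<close> nearest to the root \<open>r\<close>.\<close>
lemma clique_tree_rooted_blocks:
  assumes ct: "clique_tree n E" and r: "r < n"
  obtains p where "\<And>B. is_block n E B \<Longrightarrow> p B \<in> B"
    "\<And>v. v < n \<Longrightarrow> v \<noteq> r \<Longrightarrow> \<exists>!B. is_block n E B \<and> v \<in> B - {p B}"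
    "\<And>B. is_block n E B \<Longrightarrow> r \<notin> B - {p B}"
proof -
  have sg: "simple_graph n E" and con: "connected_on E {0..<n}"
    using ct by (auto simp: clique_tree_def)
  have sym: "\<And>x y. E x y \<Longrightarrow> E y x" using sg by (auto simp: simple_graph_def)
  have clq: "E x y" if "is_block n E B" "x \<in> B" "y \<in> B" "x \<noteq> y" for B x y
    using that ct unfolding clique_tree_def by blast
  have reach: "E\<^sup>*\<^sup>* r v" if "v < n" for v
  proof -
    have "(edge_in E {0..<n})\<^sup>*\<^sup>* r v" using con r that unfolding connected_on_iff by auto
    then show ?thesis by (rule rtranclp_mono[THEN predicate2D, rotated]) (auto simp: edge_in_def)
  qed
  let ?d = "depth E r"
  have par: "\<exists>u<n. E u v \<and> ?d u < ?d v" if v: "v < n" "v \<noteq> r" for v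
  proof -
    obtain u where "E u v" "?d u < ?d v" by (rule depth_parent[OF reach[OF v(1)] v(2)])
    moreover from this have "u < n" using sg unfolding simple_graph_def by blast
    ultimately show ?thesis by blast
  qed
  \<comment> \<open>Depth drops strictly from each vertex to its parent, so the walk from
    \<open>a\<close> to \<open>r\<close> cannot meet \<open>v\<close>, which differs from
    \<open>a\<close> and is at least as deep.\<close>
  have to_root: "(edge_in E ({0..<n} - {v}))\<^sup>*\<^sup>* a r" if "a < n" "a \<noteq> v" "?d a \<le> ?d v" for a v
    using that
  proof (induction "?d a" arbitrary: a rule: less_induct)
    case less
    show ?case
    proof (cases "a = r")
      case False
      then obtain u where u: "u < n" "E u a" "?d u < ?d a" using par less.prems(1) by blast
      then have "(edge_in E ({0..<n} - {v}))\<^sup>*\<^sup>* u r"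
        using less.prems by (intro less.hyps) auto
      moreover have "edge_in E ({0..<n} - {v}) a u" using u less.prems sym by (auto simp: edge_in_def)
      ultimately show ?thesis by (meson converse_rtranclp_into_rtranclp)
    qed simp
  qed
  \<comment> \<open>Both neighbours reach \<open>r\<close> without \<open>v\<close>, hence each
    other, and the resulting cycle through \<open>v\<close> lies in one block.\<close>
  have common: "\<exists>B. is_block n E B \<and> v \<in> B \<and> a \<in> B \<and> b \<in> B"
    if e: "E v a" "E v b" "?d a \<le> ?d v" "?d b \<le> ?d v" for v a b
  proof -
    have l: "v < n" "a < n" "b < n" "a \<noteq> v" "b \<noteq> v" using e sg unfolding simple_graph_def by blast+
    have path: "(edge_in E ({0..<n} - {v}))\<^sup>*\<^sup>* a b"
      using rtranclp_trans[OF to_root[OF l(2,4) e(3)] edge_in_sym[OF sym to_root[OF l(3,5) e(4)]]] .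
    obtain C where C: "nonseparable E C" "v \<in> C" "a \<in> C" "b \<in> C" "C \<subseteq> {0..<n} \<union> {v, a}"
      by (rule nonseparable_cycle[of E v a b "{0..<n}", OF _ e(1,2) l(4) path]) (erule sym)
    then have "C \<noteq> {}" "C \<subseteq> {0..<n}" using l by auto
    with C(1) obtain B where "is_block n E B" "C \<subseteq> B" by (rule nonseparable_subset_block)
    then show ?thesis using C by blast
  qed
  define p where "p B = arg_min_on ?d B" for B
  have fne: "finite B \<and> B \<noteq> {} \<and> B \<subseteq> {0..<n}" if "is_block n E B" for B
    using that finite_subset[of B "{0..<n}"] by (auto simp: is_block_def)
  have pB: "p B \<in> B" and pmin: "\<And>x. x \<in> B \<Longrightarrow> ?d (p B) \<le> ?d x" if "is_block n E B" for B
    using fne[OF that] arg_min_if_finite(1)[of B ?d] arg_min_least[of B _ ?d] unfolding p_def by auto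
  have puniq: "x = p B" if B: "is_block n E B" and x: "x \<in> B" "?d x = ?d (p B)" for B x
  proof (rule ccontr)
    assume ne: "x \<noteq> p B"
    have y: "p B \<in> B" "x \<noteq> p B" using pB[OF B] ne by auto
    \<comment> \<open>Of two tied vertices at least one, \<open>s\<close>, is not \<open>r\<close>.
      Its parent \<open>u\<close> lies in a block with \<open>s\<close> and \<open>t\<close>, which
      must be \<open>B\<close>, although \<open>u\<close> is nearer to \<open>r\<close> than the
      minimum over \<open>B\<close>.\<close>
    obtain s t where st: "s \<in> B" "t \<in> B" "s \<noteq> t" "?d s = ?d t" "s \<noteq> r" "?d s = ?d (p B)"
    proof (cases "x = r")
      case True
      then show ?thesis using that[of "p B" x] x y by auto
    next
      case False
      then show ?thesis using that[of x "p B"] x y by auto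
    qed
    have "s < n" using st fne[OF B] by auto
    then obtain u where u: "u < n" "E u s" "?d u < ?d s" using par st by blast
    obtain B' where "is_block n E B'" "s \<in> B'" "t \<in> B'" "u \<in> B'"
      using common[OF clq[OF B st(1-3)] sym[OF u(2)]] u st by auto
    then have "u \<in> B" using block_eqI[OF B] st by metis
    then show False using pmin[OF B, of u] u st by auto
  qed
  show ?thesis
  proof (rule that[of p, OF pB])
    fix v assume v: "v < n" "v \<noteq> r"
    then obtain u where u: "u < n" "E u v" "?d u < ?d v" using par by blast
    then obtain B where B: "is_block n E B" "u \<in> B" "v \<in> B" using edge_block[of n E u v] sg by blast
    then have "v \<in> B - {p B}" using pmin[OF B(1), of u] u by auto
    moreover have "B = B'" if "is_block n E B" "v \<in> B - {p B}" "is_block n E B'" "v \<in> B' - {p B'}" for B B'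
    proof -
      \<comment> \<open>Both tops are neighbours of \<open>v\<close> no deeper than
        \<open>v\<close>, so \<open>common\<close> puts them into one block with
        \<open>v\<close>.\<close>
      have e: "E v (p B)" "E v (p B')" using clq that pB by blast+
      moreover have "?d (p B) \<le> ?d v" "?d (p B') \<le> ?d v" using pmin that by blast+
      ultimately obtain B'' where "is_block n E B''" "v \<in> B''" "p B \<in> B''" "p B' \<in> B''"
        using common by blast
      then have "B = B''" "B' = B''" using block_eqI that pB by blast+
      then show ?thesis by simp
    qed
    ultimately show "\<exists>!B. is_block n E B \<and> v \<in> B - {p B}" using B(1) by blast
  next
    fix B assume B: "is_block n E B"
    show "r \<notin> B - {p B}"
    proof
      assume a: "r \<in> B - {p B}"
      \<comment> \<open>At depth 0 the root attains the minimum of any block containing it, so by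
        uniqueness it is the top.\<close>
      have "?d r = 0" unfolding depth_def by (rule Least_eq_0) simp
      then have "?d r = ?d (p B)" using pmin[OF B, of r] a by auto
      then show False using puniq[OF B, of r] a by auto
    qed
  qed
qed

section \<open>Cones over cliques\<close>

text \<open>With \<open>f = c / (\<lambda> + 1 - c)\<close> the slack is
  \<open>(\<lambda> - \<Sum>f) a\<^sup>2 + \<Sum> (f a - s)\<^sup>2 / f + \<Sum> (\<lambda> + 1) / c * (c q - s\<^sup>2)\<close>.\<close>
lemma cone_form_le:
  fixes c s q :: "'b \<Rightarrow> real" and l a :: real
  assumes fin: "finite I" and c: "\<And>i. i \<in> I \<Longrightarrow> 0 < c i \<and> c i < l + 1"
    and sq: "\<And>i. i \<in> I \<Longrightarrow> (s i)\<^sup>2 \<le> c i * q i"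
    and f: "(\<Sum>i\<in>I. c i / (l + 1 - c i)) \<le> l"
  shows "(\<Sum>i\<in>I. 2 * a * s i + (s i)\<^sup>2 - q i) \<le> l * (a\<^sup>2 + (\<Sum>i\<in>I. q i))"
    and "(\<Sum>i\<in>I. 2 * a * s i + (s i)\<^sup>2 - q i) = l * (a\<^sup>2 + (\<Sum>i\<in>I. q i)) \<Longrightarrow> a \<noteq> 0 \<Longrightarrow>
      (\<Sum>i\<in>I. c i / (l + 1 - c i)) = l \<and>
      (\<forall>i\<in>I. s i = c i / (l + 1 - c i) * a \<and> (s i)\<^sup>2 = c i * q i)"
proof -
  define g where "g i = c i / (l + 1 - c i)" for i
  \<comment> \<open>\<open>X i\<close> vanishes when the clique sum has its optimal value
    \<open>g i * a\<close>, \<open>Y i\<close> when Cauchy-Schwarz is tight on the clique.\<close>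
  define X where "X i = (g i * a - s i)\<^sup>2 / g i" for i
  define Y where "Y i = (l + 1) / c i * (c i * q i - (s i)\<^sup>2)" for i
  have gpos: "0 < g i" if "i \<in> I" for i using c[OF that] by (simp add: g_def)
  have X: "0 \<le> X i" if "i \<in> I" for i using gpos[OF that] by (simp add: X_def)
  have Y: "0 \<le> Y i" if "i \<in> I" for i
    using c[OF that] sq[OF that] unfolding Y_def by (intro mult_nonneg_nonneg divide_nonneg_nonneg) auto
  have summand: "l * q i - (2 * a * s i + (s i)\<^sup>2 - q i) = X i + Y i - g i * a\<^sup>2" if "i \<in> I" for i
  proof -
    have "X i = g i * a\<^sup>2 - 2 * a * s i + (s i)\<^sup>2 / g i"
      using gpos[OF that] by (simp add: X_def power2_diff field_simps power2_eq_square)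
    moreover have "(s i)\<^sup>2 / g i = (l + 1) * (s i)\<^sup>2 / c i - (s i)\<^sup>2"
      using c[OF that] by (simp add: g_def field_simps)
    moreover have "Y i = (l + 1) * q i - (l + 1) * (s i)\<^sup>2 / c i"
      using c[OF that] by (simp add: Y_def field_simps)
    ultimately show ?thesis by (simp add: algebra_simps)
  qed
  have "l * (a\<^sup>2 + (\<Sum>i\<in>I. q i)) - (\<Sum>i\<in>I. 2 * a * s i + (s i)\<^sup>2 - q i)
      = l * a\<^sup>2 + (\<Sum>i\<in>I. l * q i - (2 * a * s i + (s i)\<^sup>2 - q i))"
    by (simp add: sum_subtractf sum_distrib_left algebra_simps)
  also have "\<dots> = l * a\<^sup>2 + (\<Sum>i\<in>I. X i + Y i - g i * a\<^sup>2)" using summand by simp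
  also have "\<dots> = (l - (\<Sum>i\<in>I. g i)) * a\<^sup>2 + (\<Sum>i\<in>I. X i) + (\<Sum>i\<in>I. Y i)"
    by (simp add: sum.distrib sum_subtractf sum_distrib_right algebra_simps)
  finally have slack: "l * (a\<^sup>2 + (\<Sum>i\<in>I. q i)) - (\<Sum>i\<in>I. 2 * a * s i + (s i)\<^sup>2 - q i)
      = (l - (\<Sum>i\<in>I. g i)) * a\<^sup>2 + (\<Sum>i\<in>I. X i) + (\<Sum>i\<in>I. Y i)" .
  have nn: "0 \<le> (l - (\<Sum>i\<in>I. g i)) * a\<^sup>2" "0 \<le> (\<Sum>i\<in>I. X i)" "0 \<le> (\<Sum>i\<in>I. Y i)"
    using f X Y by (auto simp: g_def intro!: sum_nonneg mult_nonneg_nonneg)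
  show "(\<Sum>i\<in>I. 2 * a * s i + (s i)\<^sup>2 - q i) \<le> l * (a\<^sup>2 + (\<Sum>i\<in>I. q i))"
    using slack nn by linarith
  assume eq: "(\<Sum>i\<in>I. 2 * a * s i + (s i)\<^sup>2 - q i) = l * (a\<^sup>2 + (\<Sum>i\<in>I. q i))" and a: "a \<noteq> 0"
  have z: "(l - (\<Sum>i\<in>I. g i)) * a\<^sup>2 = 0" "(\<Sum>i\<in>I. X i) = 0" "(\<Sum>i\<in>I. Y i) = 0"
    using slack nn eq by linarith+
  have "s i = g i * a \<and> (s i)\<^sup>2 = c i * q i" if "i \<in> I" for i
  proof -
    have "X i = 0" "Y i = 0" using z X Y that fin by (auto simp: sum_nonneg_eq_0_iff)
    then show ?thesis using gpos[OF that] c[OF that] by (auto simp: X_def Y_def)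
  qed
  moreover have "(\<Sum>i\<in>I. g i) = l" using z(1) a by simp
  ultimately show "(\<Sum>i\<in>I. c i / (l + 1 - c i)) = l \<and>
      (\<forall>i\<in>I. s i = c i / (l + 1 - c i) * a \<and> (s i)\<^sup>2 = c i * q i)"
    unfolding g_def by blast
qed

section \<open>Cauchy-Schwarz and convexity estimates\<close>

lemma sum_squares_deviation:
  fixes w :: "'b \<Rightarrow> real"
  assumes "finite C" "C \<noteq> {}"
  shows "(\<Sum>v\<in>C. (w v - sum w C / card C)\<^sup>2) = (\<Sum>v\<in>C. (w v)\<^sup>2) - (sum w C)\<^sup>2 / card C"
proof -
  define m where "m = sum w C / card C"
  have c: "real (card C) > 0" using assms by (simp add: card_gt_0_iff)
  have "(\<Sum>v\<in>C. (w v - m)\<^sup>2) = (\<Sum>v\<in>C. (w v)\<^sup>2) - 2 * m * sum w C + card C * m\<^sup>2"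
    by (simp add: power2_diff sum.distrib sum_subtractf sum_distrib_left sum_distrib_right algebra_simps)
  also have "\<dots> = (\<Sum>v\<in>C. (w v)\<^sup>2) - (sum w C)\<^sup>2 / card C"
    using c by (simp add: m_def power2_eq_square field_simps)
  finally show ?thesis by (simp add: m_def)
qed

text \<open>Cauchy-Schwarz as a variance: the gap is \<open>card C\<close> times the sum of squared
  deviations from the mean, so equality makes \<open>w\<close> constant on \<open>C\<close>.\<close>

lemma sum_power2_le_card_mult:
  fixes w :: "'b \<Rightarrow> real"
  assumes "finite C" "C \<noteq> {}"
  shows "(sum w C)\<^sup>2 \<le> card C * (\<Sum>v\<in>C. (w v)\<^sup>2)"
    and "(sum w C)\<^sup>2 = card C * (\<Sum>v\<in>C. (w v)\<^sup>2) \<Longrightarrow> v \<in> C \<Longrightarrow> w v = sum w C / card C"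
proof -
  have c: "real (card C) > 0" using assms by (simp add: card_gt_0_iff)
  have "0 \<le> (\<Sum>v\<in>C. (w v - sum w C / card C)\<^sup>2)" by (simp add: sum_nonneg)
  then show "(sum w C)\<^sup>2 \<le> card C * (\<Sum>v\<in>C. (w v)\<^sup>2)"
    unfolding sum_squares_deviation[OF assms] using c by (simp add: field_simps)
  assume "(sum w C)\<^sup>2 = card C * (\<Sum>v\<in>C. (w v)\<^sup>2)" "v \<in> C"
  then have "(\<Sum>v\<in>C. (w v - sum w C / card C)\<^sup>2) = 0"
    unfolding sum_squares_deviation[OF assms] using c by simp
  then have "(w v - sum w C / card C)\<^sup>2 = 0"
    by (rule sum_nonneg_0[OF assms(1) zero_le_power2 _ \<open>v \<in> C\<close>])
  then show "w v = sum w C / card C" unfolding power2_eq_square by simp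
qed

text \<open>The right-hand side is the chord through 2 and \<open>b\<close> of the convex function
  \<open>x / (L - x)\<close>. The gap has numerator \<open>L * (x - 2) * (b - x)\<close>, which also
  settles equality.\<close>

lemma chord_bound:
  fixes x b L :: real
  assumes "2 \<le> x" "x \<le> b" "b < L"
  shows "x / (L - x) \<le> 2 / (L - 2) + (x - 2) * (L / ((L - b) * (L - 2)))"
    and "x / (L - x) = 2 / (L - 2) + (x - 2) * (L / ((L - b) * (L - 2))) \<Longrightarrow> x = 2 \<or> x = b"
proof -
  have p: "0 < L - x" "0 < L - b" "0 < L - 2" "0 < L" using assms by auto
  have "2 / (L - 2) + (x - 2) * (L / ((L - b) * (L - 2))) - x / (L - x)
     = L * (x - 2) * (b - x) / ((L - b) * (L - 2) * (L - x))" (is "?D = ?N / ?M")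
  proof -
    have "2 / (L - 2) = 2 * ((L - b) * (L - x)) / ((L - 2) * ((L - b) * (L - x)))"
      "x / (L - x) = x * ((L - b) * (L - 2)) / ((L - x) * ((L - b) * (L - 2)))"
      "(x - 2) * (L / ((L - b) * (L - 2))) = (x - 2) * L * (L - x) / ((L - b) * (L - 2) * (L - x))"
      using p by (simp_all del: right_diff_distrib left_diff_distrib)
    then have "2 / (L - 2) = 2 * (L - b) * (L - x) / ?M" "x / (L - x) = x * (L - b) * (L - 2) / ?M"
      "(x - 2) * (L / ((L - b) * (L - 2))) = (x - 2) * L * (L - x) / ?M"
      by (simp_all only: mult_ac)
    then have "?D = (2 * (L - b) * (L - x) + (x - 2) * L * (L - x) - x * (L - b) * (L - 2)) / ?M"
      by (simp add: add_divide_distrib diff_divide_distrib)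
    also have "2 * (L - b) * (L - x) + (x - 2) * L * (L - x) - x * (L - b) * (L - 2) = ?N"
      by (simp add: algebra_simps)
    finally show ?thesis .
  qed
  moreover have "0 \<le> ?N / ?M" using p assms by (intro divide_nonneg_nonneg mult_nonneg_nonneg) auto
  ultimately show "x / (L - x) \<le> 2 / (L - 2) + (x - 2) * (L / ((L - b) * (L - 2)))" by linarith
  assume "x / (L - x) = 2 / (L - 2) + (x - 2) * (L / ((L - b) * (L - 2)))"
  then have "?N / ?M = 0" using \<open>?D = ?N / ?M\<close> by linarith
  then show "x = 2 \<or> x = b" using p by auto
qed

text \<open>There are at least \<open>t\<close> other summands, and they use up at least
  \<open>2 * t\<close> of the total.\<close>

lemma summand_le:
  fixes c :: "'b \<Rightarrow> nat"
  assumes fin: "finite I" and c2: "\<And>i. i \<in> I \<Longrightarrow> 2 \<le> c i" and sum: "(\<Sum>i\<in>I. c i) = b + 2 * t"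
    and card: "t + 1 \<le> card I" and i: "i \<in> I"
  shows "c i \<le> b"
proof -
  have "2 * card (I - {i}) \<le> (\<Sum>j\<in>I - {i}. c j)"
    using sum_mono[of "I - {i}" "\<lambda>_. 2" c] c2 by auto
  moreover have "(\<Sum>j\<in>I. c j) = c i + (\<Sum>j\<in>I - {i}. c j)" using fin i by (rule sum.remove)
  moreover have "card (I - {i}) = card I - 1" using i fin by simp
  ultimately show ?thesis using sum card by linarith
qed

text \<open>In the sum of the chord bounds the total of the \<open>c i\<close> is fixed, so only
  \<open>card I\<close> matters, and each summand beyond \<open>t + 1\<close> lowers the bound.
  Equality leaves no excess and puts every \<open>c i\<close> at an end of the chord.\<close>

lemma sum_convex_le:
  fixes c :: "'b \<Rightarrow> nat" and L :: real and b t :: nat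
  assumes fin: "finite I" and c2: "\<And>i. i \<in> I \<Longrightarrow> 2 \<le> c i" and sum: "(\<Sum>i\<in>I. c i) = b + 2 * t"
    and card: "t + 1 \<le> card I" and b: "2 \<le> b" "b < L"
  shows "(\<Sum>i\<in>I. c i / (L - c i)) \<le> b / (L - b) + t * (2 / (L - 2))"
    and "(\<Sum>i\<in>I. c i / (L - c i)) = b / (L - b) + t * (2 / (L - 2)) \<Longrightarrow>
      card I = t + 1 \<and> (\<forall>i\<in>I. c i = 2 \<or> c i = b)"
proof -
  \<comment> \<open>\<open>K\<close> is the slope of the chord, \<open>d\<close> the number of
    summands in excess of \<open>t + 1\<close>.\<close>
  define K where "K = L / ((L - b) * (L - 2))"
  define d where "d = real (card I) - (t + 1)"
  have p: "0 < L - b" "0 < L - 2" "0 < L" using b by auto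
  have d: "0 \<le> d" using card by (simp add: d_def)
  have cb: "c i \<le> b" if "i \<in> I" for i
    using assms(1-4) that by (rule summand_le)
  have le: "c i / (L - c i) \<le> 2 / (L - 2) + (real (c i) - 2) * K" if "i \<in> I" for i
    using chord_bound(1)[of "real (c i)" b L] c2[OF that] cb[OF that] b unfolding K_def by simp
  have "(\<Sum>i\<in>I. 2 / (L - 2) + (real (c i) - 2) * K) =
      card I * (2 / (L - 2)) + ((\<Sum>i\<in>I. real (c i)) - 2 * real (card I)) * K"
    by (simp add: sum.distrib sum_distrib_right[symmetric] sum_subtractf)
  also have "(\<Sum>i\<in>I. real (c i)) = b + 2 * t" using sum by (metis of_nat_add of_nat_mult of_nat_numeral of_nat_sum)
  also have "real (card I) = d + (t + 1)" by (simp add: d_def)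
  also have "(d + (t + 1)) * (2 / (L - 2)) + (real (b + 2 * t) - 2 * (d + (t + 1))) * K =
      t * (2 / (L - 2)) + (2 / (L - 2) + (real b - 2) * K) + d * (2 / (L - 2) - 2 * K)"
    by (simp add: algebra_simps add_divide_distrib)
  finally have total: "(\<Sum>i\<in>I. 2 / (L - 2) + (real (c i) - 2) * K) =
      t * (2 / (L - 2)) + (2 / (L - 2) + (real b - 2) * K) + d * (2 / (L - 2) - 2 * K)" .
  have at_b: "2 / (L - 2) + (real b - 2) * K = b / (L - b)"
  proof -
    have "2 / (L - 2) = 2 * (L - b) / ((L - b) * (L - 2))"
      using p by (simp del: right_diff_distrib left_diff_distrib right_diff_distrib_numeral)
    then have "2 / (L - 2) + (real b - 2) * K = (2 * (L - b) + (real b - 2) * L) / ((L - b) * (L - 2))"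
      by (simp add: K_def add_divide_distrib)
    also have "2 * (L - b) + (real b - 2) * L = b * (L - 2)" by (simp add: algebra_simps)
    finally show ?thesis using p by simp
  qed
  \<comment> \<open>Over the common denominator the numerator is \<open>- 2 * b\<close>.\<close>
  have neg: "2 / (L - 2) - 2 * K < 0"
  proof -
    have "2 / (L - 2) = 2 * (L - b) / ((L - b) * (L - 2))"
      using p by (simp del: right_diff_distrib left_diff_distrib right_diff_distrib_numeral)
    then have "2 / (L - 2) - 2 * K = (2 * (L - b) - 2 * L) / ((L - b) * (L - 2))"
      by (simp add: K_def diff_divide_distrib)
    also have "\<dots> < 0" using p b by (intro divide_neg_pos) auto
    finally show ?thesis .
  qed
  have sle: "(\<Sum>i\<in>I. c i / (L - c i)) \<le> (\<Sum>i\<in>I. 2 / (L - 2) + (real (c i) - 2) * K)"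
    by (rule sum_mono) (rule le)
  have dn: "d * (2 / (L - 2) - 2 * K) \<le> 0" using d neg by (simp add: mult_nonneg_nonpos)
  show "(\<Sum>i\<in>I. c i / (L - c i)) \<le> b / (L - b) + t * (2 / (L - 2))"
    using sle total at_b dn by linarith
  assume eq: "(\<Sum>i\<in>I. c i / (L - c i)) = b / (L - b) + t * (2 / (L - 2))"
  then have "d * (2 / (L - 2) - 2 * K) = 0" and
    s: "(\<Sum>i\<in>I. c i / (L - c i)) = (\<Sum>i\<in>I. 2 / (L - 2) + (real (c i) - 2) * K)"
    using sle total at_b dn by linarith+
  then have "d = 0" using neg by simp
  moreover have "c i = 2 \<or> c i = b" if i: "i \<in> I" for i
  proof -
    have "c i / (L - c i) = 2 / (L - 2) + (real (c i) - 2) * K"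
      using sum_mono_inv[OF s le i fin] by simp
    then have "real (c i) = 2 \<or> real (c i) = b"
      using chord_bound(2)[of "real (c i)" b L] c2[OF i] cb[OF i] b unfolding K_def by simp
    then show ?thesis by linarith
  qed
  ultimately show "card I = t + 1 \<and> (\<forall>i\<in>I. c i = 2 \<or> c i = b)" by (auto simp: d_def)
qed

text \<open>With weight 1 at the apex and \<open>1 / (l + 1 - c)\<close> on a clique of size
  \<open>c\<close>, this is the eigenvalue equation at the apex of the cone over one clique of size
  \<open>b\<close> and \<open>t\<close> cliques of size 2. A root with \<open>b \<le> l\<close>
  keeps all denominators positive.\<close>

lemma cone_root_exists:
  fixes b t :: nat
  assumes "2 \<le> b"
  obtains l :: real where "b \<le> l" "b / (l + 1 - b) + t * (2 / (l + 1 - 2)) = l"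
proof -
  let ?g = "\<lambda>x::real. x - (b / (x + 1 - b) + t * (2 / (x + 1 - 2)))"
  have b: "2 \<le> real b" using assms by simp
  have "\<exists>x\<ge>real b. x \<le> real b + 2 * t \<and> ?g x = 0"
  proof (rule IVT')
    \<comment> \<open>At the left end the first fraction equals \<open>b\<close>; at the right end
      the two terms are at most \<open>b\<close> and \<open>2 * t\<close>.\<close>
    show "?g (real b) \<le> 0" using b by simp
    have "b / (real b + 2 * t + 1 - b) \<le> real b" 
      using frac_le[of "real b" "real b" 1 "2 * real t + 1"] by simp
    moreover have "t * (2 / (real b + 2 * t + 1 - 2)) \<le> real t * 2"
      using b frac_le[of 2 2 1 "real b + 2 * t + 1 - 2"] by (intro mult_left_mono) auto
    ultimately show "0 \<le> ?g (real b + 2 * t)" by linarith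
    show "continuous_on {real b..real b + 2 * t} ?g"
      by (intro continuous_intros) (use b in auto)
  qed simp
  then obtain x where "real b \<le> x" "?g x = 0" by blast
  then show ?thesis by (intro that[of x]) auto
qed

section \<open>Comparing a clique tree with the cone\<close>

text \<open>Ordered adjacent pairs split by blocks, since two blocks share at most one vertex. A
  block with top weight \<open>a\<close> and remaining weights of sum \<open>s\<close> and square
  sum \<open>q\<close> contributes (a + s)^2 - (a^2 + q).\<close>

lemma clique_tree_form:
  fixes w :: "nat \<Rightarrow> real"
  assumes ct: "clique_tree n E" and p: "\<And>B. is_block n E B \<Longrightarrow> p B \<in> B"
  shows "(\<Sum>i<n. \<Sum>j<n. if E i j then w i * w j else 0) =
    (\<Sum>B\<in>{B. is_block n E B}. 2 * w (p B) * sum w (B - {p B}) + (sum w (B - {p B}))\<^sup>2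
      - (\<Sum>v\<in>B - {p B}. (w v)\<^sup>2))"
proof -
  let ?I = "{B. is_block n E B}"
  let ?D = "\<lambda>B. {(i, j). i \<in> B \<and> j \<in> B \<and> i \<noteq> j}"
  have fin: "finite B" if "is_block n E B" for B
    using that finite_subset[of B "{0..<n}"] by (auto simp: is_block_def)
  have D: "?D B = B \<times> B - (\<lambda>i. (i, i)) ` B" for B by auto
  have "(\<Sum>i<n. \<Sum>j<n. if E i j then w i * w j else 0) =
      (\<Sum>x\<in>{..<n} \<times> {..<n}. if case_prod E x then (case x of (i, j) \<Rightarrow> w i * w j) else 0)"
    by (auto simp: sum.cartesian_product intro!: sum.cong)
  also have "\<dots> = (\<Sum>x\<in>{x \<in> {..<n} \<times> {..<n}. case_prod E x}. case x of (i, j) \<Rightarrow> w i * w j)"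
    by (rule sum.inter_filter[symmetric]) simp
  also have "{x \<in> {..<n} \<times> {..<n}. case_prod E x} = (\<Union>B\<in>?I. ?D B)"
  proof -
    have "(x \<in> {x \<in> {..<n} \<times> {..<n}. case_prod E x}) = (x \<in> (\<Union>B\<in>?I. ?D B))" for x
    proof (cases x)
      case (Pair i j)
      have "i < n \<and> j < n" if "E i j" using that ct by (auto simp: clique_tree_def simple_graph_def)
      then show ?thesis using Pair clique_tree_edge_iff[OF ct, of i j] by auto
    qed
    then show ?thesis by blast
  qed
  also have "(\<Sum>x\<in>(\<Union>B\<in>?I. ?D B). case x of (i, j) \<Rightarrow> w i * w j) =
      (\<Sum>B\<in>?I. \<Sum>x\<in>?D B. case x of (i, j) \<Rightarrow> w i * w j)"
  proof (rule sum.UNION_disjoint)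
    show "finite ?I" by (rule finite_blocks)
    show "\<forall>B\<in>?I. finite (?D B)" unfolding D using fin by auto
    have "B = B'" if "is_block n E B" "is_block n E B'" "x \<in> ?D B" "x \<in> ?D B'" for B B' x
      using that block_eqI[of n E B B' "fst x" "snd x"] by auto
    then show "\<forall>B\<in>?I. \<forall>B'\<in>?I. B \<noteq> B' \<longrightarrow> ?D B \<inter> ?D B' = {}" by blast
  qed
  also have "\<dots> = (\<Sum>B\<in>?I. 2 * w (p B) * sum w (B - {p B}) + (sum w (B - {p B}))\<^sup>2
      - (\<Sum>v\<in>B - {p B}. (w v)\<^sup>2))"
  proof (rule sum.cong[OF refl])
    fix B assume "B \<in> ?I"
    then have B: "finite B" "p B \<in> B" using fin p by auto
    have "(\<Sum>x\<in>?D B. case x of (i, j) \<Rightarrow> w i * w j) =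
        (\<Sum>x\<in>B \<times> B. case x of (i, j) \<Rightarrow> w i * w j) - (\<Sum>x\<in>(\<lambda>i. (i, i)) ` B. case x of (i, j) \<Rightarrow> w i * w j)"
      unfolding D using B(1) by (intro sum_diff) auto
    also have "(\<Sum>x\<in>B \<times> B. case x of (i, j) \<Rightarrow> w i * w j) = (sum w B)\<^sup>2"
      by (simp add: sum.cartesian_product[symmetric] power2_eq_square sum_product)
    also have "(\<Sum>x\<in>(\<lambda>i. (i, i)) ` B. case x of (i, j) \<Rightarrow> w i * w j) = (\<Sum>v\<in>B. (w v)\<^sup>2)"
      by (subst sum.reindex) (auto simp: inj_on_def power2_eq_square)
    also have "sum w B = w (p B) + sum w (B - {p B})" using B by (rule sum.remove)
    also have "(\<Sum>v\<in>B. (w v)\<^sup>2) = (w (p B))\<^sup>2 + (\<Sum>v\<in>B - {p B}. (w v)\<^sup>2)" using B by (rule sum.remove)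
    finally show "(\<Sum>x\<in>?D B. case x of (i, j) \<Rightarrow> w i * w j) =
       2 * w (p B) * sum w (B - {p B}) + (sum w (B - {p B}))\<^sup>2 - (\<Sum>v\<in>B - {p B}. (w v)\<^sup>2)"
      by (simp add: power2_sum)
  qed
  finally show ?thesis .
qed

text \<open>The cone inequality is applied to the cliques \<open>B - {p B}\<close>, whose sizes sum
  to \<open>n - 1\<close>; \<open>l\<close> solves the cone equation for the extremal sizes. The
  second part extracts from equality the data that fix the graph up to isomorphism.\<close>

lemma clique_tree_spectral_radius_le:
  fixes l :: real
  assumes ct: "clique_tree n E" and c3: "\<And>B. is_block n E B \<Longrightarrow> 3 \<le> card B"
    and card: "t + 1 \<le> card {B. is_block n E B}" and n: "n = b + 1 + 2 * t" and b: "2 \<le> b"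
    and bl: "b \<le> l" and root: "b / (l + 1 - b) + t * (2 / (l + 1 - 2)) = l"
  shows "spectral_radius (adj_matrix n E) \<le> l"
    and "spectral_radius (adj_matrix n E) = l \<Longrightarrow>
      \<exists>r<n. (\<forall>v<n. \<exists>B. is_block n E B \<and> v \<in> B) \<and>
        (\<forall>B. is_block n E B \<longrightarrow> r \<in> B \<and> (card (B - {r}) = 2 \<or> card (B - {r}) = b)) \<and>
        card {B. is_block n E B} = t + 1 \<and>
        (\<Sum>B\<in>{B. is_block n E B}. card (B - {r})) = b + 2 * t"
proof -
  define I where "I = {B. is_block n E B}"
  let ?R = "spectral_radius (adj_matrix n E)"
  have n0: "0 < n" using n by simp
  have finI: "finite I" unfolding I_def by (rule finite_blocks)
  have finB: "finite B" "B \<subseteq> {0..<n}" if "B \<in> I" for B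
    using that finite_subset[of B "{0..<n}"] by (auto simp: is_block_def I_def)
  obtain w :: "nat \<Rightarrow> real" where w: "\<And>i. 0 \<le> w i" "\<exists>i<n. 0 < w i"
    "?R * (\<Sum>i<n. (w i)\<^sup>2) \<le> (\<Sum>i<n. \<Sum>j<n. if E i j then w i * w j else 0)"
    using spectral_radius_nonneg_vector[OF n0, of E] by blast
  \<comment> \<open>Rooting at a vertex of largest weight ensures that replacing a top
    \<open>p B\<close> by \<open>r\<close> cannot lower the form.\<close>
  have "finite (w ` {..<n})" "w ` {..<n} \<noteq> {}" using n0 by auto
  then have "Max (w ` {..<n}) \<in> w ` {..<n}" by (rule Max_in)
  then obtain r where r: "r < n" "Max (w ` {..<n}) = w r" by auto
  have wr: "w v \<le> w r" if "v < n" for v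
    using that Max_ge[of "w ` {..<n}" "w v"] by (simp add: r(2))
  have wpos: "0 < w r" using w(2) wr by (meson less_le_trans)
  obtain p where p: "\<And>B. is_block n E B \<Longrightarrow> p B \<in> B"
    "\<And>v. v < n \<Longrightarrow> v \<noteq> r \<Longrightarrow> \<exists>!B. is_block n E B \<and> v \<in> B - {p B}"
    "\<And>B. is_block n E B \<Longrightarrow> r \<notin> B - {p B}"
    using clique_tree_rooted_blocks[OF ct r(1)] by blast
  define C where "C B = B - {p B}" for B
  define s where "s B = sum w (C B)" for B
  define q where "q B = (\<Sum>v\<in>C B. (w v)\<^sup>2)" for B
  define c where "c B = card (C B)" for B
  have finC: "finite (C B)" if "B \<in> I" for B using finB[OF that] by (simp add: C_def)
  have c2: "2 \<le> c B" if "B \<in> I" for B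
    using that c3[of B] p(1)[of B] finB(1)[OF that] by (auto simp: c_def C_def I_def)
  have neC: "C B \<noteq> {}" if "B \<in> I" for B using c2[OF that] by (auto simp: c_def)
  have UN: "(\<Union>B\<in>I. C B) = {..<n} - {r}"
  proof
    show "(\<Union>B\<in>I. C B) \<subseteq> {..<n} - {r}"
      using finB(2) p(3) by (force simp: C_def I_def)
    show "{..<n} - {r} \<subseteq> (\<Union>B\<in>I. C B)"
      using p(2) by (fastforce simp: C_def I_def)
  qed
  have disj: "C B \<inter> C B' = {}" if "B \<in> I" "B' \<in> I" "B \<noteq> B'" for B B'
  proof (rule ccontr)
    assume "C B \<inter> C B' \<noteq> {}"
    then obtain v where v: "v \<in> C B" "v \<in> C B'" by blast
    then have "v < n" "v \<noteq> r" using UN that by blast+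
    then have "\<exists>!B. is_block n E B \<and> v \<in> B - {p B}" by (rule p(2))
    then show False using v that unfolding C_def I_def by blast
  qed
  \<comment> \<open>Serves twice: to count vertices and to sum squared weights.\<close>
  have part: "(\<Sum>B\<in>I. sum g (C B)) = sum g ({..<n} - {r})" for g :: "nat \<Rightarrow> 'a :: comm_monoid_add"
    unfolding UN[symmetric] using finI finC disj by (intro sum.UNION_disjoint[symmetric]) auto
  have csum: "(\<Sum>B\<in>I. c B) = b + 2 * t"
    using part[of "\<lambda>_. 1 :: nat"] r(1) n by (simp add: c_def)
  have qsum: "(\<Sum>i<n. (w i)\<^sup>2) = (w r)\<^sup>2 + (\<Sum>B\<in>I. q B)"
    using part[of "\<lambda>v. (w v)\<^sup>2"] sum.remove[of "{..<n}" r "\<lambda>v. (w v)\<^sup>2"] r(1) by (simp add: q_def)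
  have cardI: "t + 1 \<le> card I" using card by (simp add: I_def)
  have cb: "c B \<le> b" if "B \<in> I" for B using finI c2 csum cardI that by (rule summand_le)
  have cl: "0 < real (c B) \<and> real (c B) < l + 1" if "B \<in> I" for B using cb[OF that] c2[OF that] bl by linarith
  have bL: "b < l + 1" using bl by simp
  have f: "(\<Sum>B\<in>I. real (c B) / (l + 1 - real (c B))) \<le> l"
    using sum_convex_le(1)[OF finI c2 csum cardI b bL] root by simp
  have sq: "(s B)\<^sup>2 \<le> real (c B) * q B" if "B \<in> I" for B
    using sum_power2_le_card_mult(1)[OF finC[OF that] neC[OF that]] by (simp add: s_def c_def q_def)
  have spos: "0 \<le> s B" for B unfolding s_def using w(1) by (simp add: sum_nonneg)
  have form: "(\<Sum>i<n. \<Sum>j<n. if E i j then w i * w j else 0) =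
      (\<Sum>B\<in>I. 2 * w (p B) * s B + (s B)\<^sup>2 - q B)"
    using clique_tree_form[OF ct p(1)] by (simp add: I_def s_def q_def C_def)
  have pn: "p B < n" if "B \<in> I" for B using finB(2)[OF that] p(1)[of B] that by (auto simp: I_def)
  have raise: "2 * w (p B) * s B + (s B)\<^sup>2 - q B \<le> 2 * w r * s B + (s B)\<^sup>2 - q B" if "B \<in> I" for B
    using mult_right_mono[OF wr[OF pn[OF that]] spos[of B]] by simp
  have raise_sum: "(\<Sum>B\<in>I. 2 * w (p B) * s B + (s B)\<^sup>2 - q B) \<le> (\<Sum>B\<in>I. 2 * w r * s B + (s B)\<^sup>2 - q B)"
    by (rule sum_mono) (rule raise)
  have cone: "(\<Sum>B\<in>I. 2 * w r * s B + (s B)\<^sup>2 - q B) \<le> l * (\<Sum>i<n. (w i)\<^sup>2)"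
    unfolding qsum using finI cl sq f by (rule cone_form_le(1))
  have N: "0 < (\<Sum>i<n. (w i)\<^sup>2)"
    unfolding qsum using wpos by (auto simp: q_def intro!: add_pos_nonneg sum_nonneg)
  have "?R * (\<Sum>i<n. (w i)\<^sup>2) \<le> l * (\<Sum>i<n. (w i)\<^sup>2)" using w(3) form raise_sum cone by linarith
  then show "?R \<le> l" using N by simp
  assume "?R = l"
  \<comment> \<open>The chain of inequalities from \<open>?R\<close> to \<open>l\<close> collapses:
    moving the tops gained nothing, and the cone bound is attained.\<close>
  then have eq1: "(\<Sum>B\<in>I. 2 * w (p B) * s B + (s B)\<^sup>2 - q B) = (\<Sum>B\<in>I. 2 * w r * s B + (s B)\<^sup>2 - q B)"
    and eq2: "(\<Sum>B\<in>I. 2 * w r * s B + (s B)\<^sup>2 - q B) = l * ((w r)\<^sup>2 + (\<Sum>B\<in>I. q B))"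
    using w(3) form raise_sum cone qsum by (auto intro!: antisym)
  have "(\<Sum>B\<in>I. real (c B) / (l + 1 - real (c B))) = l \<and>
      (\<forall>B\<in>I. s B = real (c B) / (l + 1 - real (c B)) * w r \<and> (s B)\<^sup>2 = real (c B) * q B)"
    using finI cl sq f eq2 wpos by (intro cone_form_le(2)) auto
  then have fl: "(\<Sum>B\<in>I. real (c B) / (l + 1 - real (c B))) = l"
    and sB: "\<And>B. B \<in> I \<Longrightarrow> s B = real (c B) / (l + 1 - real (c B)) * w r"
    and sqB: "\<And>B. B \<in> I \<Longrightarrow> (s B)\<^sup>2 = real (c B) * q B" by blast+
  have fpos: "0 < real (c B) / (l + 1 - real (c B))" if "B \<in> I" for B using cl[OF that] by simp
  \<comment> \<open>Tight Cauchy-Schwarz makes \<open>w\<close> constant on \<open>C B\<close>, and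
    the known sum \<open>s B\<close> gives the constant.\<close>
  have wC: "w v = w r / (l + 1 - real (c B))" if "B \<in> I" "v \<in> C B" for B v
  proof -
    have "w v = s B / real (c B)"
      using sum_power2_le_card_mult(2)[OF finC[OF that(1)] neC[OF that(1)], of w v] sqB[OF that(1)] that(2)
      by (simp add: s_def c_def q_def)
    then show ?thesis using sB[OF that(1)] cl[OF that(1)] by simp
  qed
  \<comment> \<open>Equality holds in every summand, and the positive factor \<open>s B\<close>
    cancels.\<close>
  have wp: "w (p B) = w r" if "B \<in> I" for B
  proof -
    have "2 * w (p B) * s B + (s B)\<^sup>2 - q B = 2 * w r * s B + (s B)\<^sup>2 - q B"
      using sum_mono_inv[OF eq1 raise that finI] by simp
    moreover have "0 < s B" unfolding sB[OF that] using fpos[OF that] wpos by (rule mult_pos_pos)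
    ultimately show ?thesis by simp
  qed
  \<comment> \<open>A top other than \<open>r\<close> lies in some \<open>C B'\<close> and so has
    weight \<open>w r / (l + 1 - c B')\<close>; this equals \<open>w r\<close> only if
    \<open>c B' = l\<close>. The summand of \<open>B'\<close> alone is then \<open>l\<close>, and
    the positive summand of \<open>B\<close> pushes the sum above \<open>l\<close>.\<close>
  have pr: "p B = r" if B: "B \<in> I" for B
  proof (rule ccontr)
    assume "p B \<noteq> r"
    then obtain B' where B': "B' \<in> I" "p B \<in> C B'" using p(2)[OF pn[OF B]] unfolding C_def I_def by blast
    then have ne: "B' \<noteq> B" by (auto simp: C_def)
    have "w r = w r / (l + 1 - real (c B'))" using wC[OF B'] wp[OF B] by simp
    then have "w r * (l + 1 - real (c B')) = w r * 1" using cl[OF B'(1)] by (simp add: eq_divide_eq)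
    then have "l + 1 - real (c B') = 1" using wpos by (simp only: mult_cancel_left) simp
    then have "real (c B') / (l + 1 - real (c B')) = l" by simp
    moreover have "(\<Sum>B\<in>{B, B'}. real (c B) / (l + 1 - real (c B))) \<le> (\<Sum>B\<in>I. real (c B) / (l + 1 - real (c B)))"
      using finI B B'(1) fpos by (intro sum_mono2) (auto intro: less_imp_le)
    ultimately show False using fl fpos[OF B] ne by simp
  qed
  \<comment> \<open>By \<open>fl\<close> and \<open>root\<close> both sides of the convexity bound
    equal \<open>l\<close>, so its equality case applies.\<close>
  have fin: "card I = t + 1 \<and> (\<forall>B\<in>I. c B = 2 \<or> c B = b)"
    using finI c2 csum cardI b bL by (rule sum_convex_le(2)) (assumption | rule trans[OF fl root[symmetric]])+
  have cr: "c B = card (B - {r})" if "B \<in> I" for B using pr[OF that] by (simp add: c_def C_def)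
  have cover: "\<exists>B. is_block n E B \<and> v \<in> B" if "v < n" for v
  proof (cases "v = r")
    case True
    obtain B where "B \<in> I" using cardI by (metis One_nat_def add_is_0 card.empty ex_in_conv le_zero_eq nat.simps(3))
    then show ?thesis using True pr p(1) unfolding I_def by blast
  next
    case False
    then show ?thesis using p(2)[OF that] by blast
  qed
  show "\<exists>r<n. (\<forall>v<n. \<exists>B. is_block n E B \<and> v \<in> B) \<and>
        (\<forall>B. is_block n E B \<longrightarrow> r \<in> B \<and> (card (B - {r}) = 2 \<or> card (B - {r}) = b)) \<and>
        card {B. is_block n E B} = t + 1 \<and>
        (\<Sum>B\<in>{B. is_block n E B}. card (B - {r})) = b + 2 * t"
  proof (intro exI[of _ r] conjI allI impI)
    fix B assume "is_block n E B"
    then have "B \<in> I" by (simp add: I_def)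
    then show "r \<in> B" "card (B - {r}) = 2 \<or> card (B - {r}) = b" using pr p(1)[of B] fin cr by (auto simp: I_def)
  next
    show "(\<Sum>B\<in>{B. is_block n E B}. card (B - {r})) = b + 2 * t"
      using csum cr by (simp add: I_def)
  qed (use r fin cover in \<open>auto simp: I_def\<close>)
qed

section \<open>The extremal graph\<close>

text \<open>The conditional expressions label the cliques: 0 for the large one, \<open>Suc j\<close>
  for triangle \<open>j\<close>, counted from 0. Distinct vertices other than 0 are adjacent when
  their labels agree, the form in which blocks are matched later.\<close>

lemma extremal_graph_iff:
  assumes "2 * k + 2 - n = m" "0 < m"
  shows "extremal_graph n k x y \<longleftrightarrow> x < n \<and> y < n \<and> x \<noteq> y \<and> (x = 0 \<or> y = 0 \<or>
    (if x < m then 0 else Suc ((x - m) div 2)) = (if y < m then 0 else Suc ((y - m) div 2)))"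
  using assms(2) unfolding extremal_graph_def Let_def assms(1) by (auto split: if_splits)

text \<open>An explicit eigenvector for \<open>l\<close>: 1 at the common vertex, \<open>u\<close>
  on the rest of the large clique, \<open>v\<close> on the triangles. Rows away from the common
  vertex determine \<open>u\<close> and \<open>v\<close>; its own row is
  \<open>root\<close>.\<close>

lemma spectral_radius_extremal_graph_ge:
  fixes l :: real and b t :: nat
  assumes m: "2 * k + 2 - n = b + 1" and n: "n = b + 1 + 2 * t" and b: "2 \<le> b"
    and bl: "b \<le> l" and root: "b / (l + 1 - b) + t * (2 / (l + 1 - 2)) = l"
  shows "l \<le> spectral_radius (adj_matrix n (extremal_graph n k))"
proof -
  define u v where "u = 1 / (l + 1 - b)" and "v = 1 / (l + 1 - 2)"
  have u: "1 + (real b - 1) * u = l * u" and v: "1 + v = l * v"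
    using bl b by (simp_all add: u_def v_def field_simps)
  define y where "y x = (if x = 0 then 1 else if x < b + 1 then u else v)" for x :: nat
  let ?N = "\<lambda>i. {j. j < n \<and> extremal_graph n k i j}"
  have gt: "b + 1 \<le> n" using n by simp
  note ext = extremal_graph_iff[OF m zero_less_Suc[of b, unfolded Suc_eq_plus1]]
  have row: "(\<Sum>j\<in>?N i. y j) = l * y i" if i: "i < n" for i
  proof -
    consider "i = 0" | "0 < i" "i < b + 1" | "b + 1 \<le> i" by linarith
    then show ?thesis
    proof cases
      case 1
      have "?N i = {1..<b + 1} \<union> {b + 1..<n}" unfolding ext using 1 gt by auto
      then have "(\<Sum>j\<in>?N i. y j) = (\<Sum>j\<in>{1..<b + 1}. y j) + (\<Sum>j\<in>{b + 1..<n}. y j)"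
        by (simp add: sum.union_disjoint)
      also have "(\<Sum>j\<in>{1..<b + 1}. y j) = b * u" by (simp add: y_def)
      also have "(\<Sum>j\<in>{b + 1..<n}. y j) = 2 * t * v" using n by (simp add: y_def)
      finally show ?thesis using root 1 by (simp add: y_def u_def v_def mult.commute)
    next
      case 2
      have "?N i = insert 0 ({1..<b + 1} - {i})" unfolding ext using 2 gt by (auto split: if_splits)
      then have "(\<Sum>j\<in>?N i. y j) = y 0 + (\<Sum>j\<in>{1..<b + 1} - {i}. y j)" by simp
      also have "(\<Sum>j\<in>{1..<b + 1} - {i}. y j) = (\<Sum>j\<in>{1..<b + 1} - {i}. u)"
        by (rule sum.cong) (auto simp: y_def)
      also have "\<dots> = (real b - 1) * u" using 2 b by (simp add: of_nat_diff)
      finally show ?thesis using u 2 by (simp add: y_def)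
    next
      case 3
      define a where "a = (i - (b + 1)) div 2"
      have "i = b + 1 + 2 * a \<or> i = b + 2 + 2 * a" using 3 unfolding a_def by linarith
      \<comment> \<open>\<open>i'\<close> is the third vertex of the triangle containing 0 and
        \<open>i\<close>.\<close>
      define i' where "i' = (if i = b + 1 + 2 * a then b + 2 + 2 * a else b + 1 + 2 * a)"
      have i': "{i, i'} = {b + 1 + 2 * a, b + 2 + 2 * a}" "i' \<noteq> i"
        using \<open>i = _ \<or> i = _\<close> by (auto simp: i'_def)
      have "a < t" using \<open>i = _ \<or> i = _\<close> i n by linarith
      then have i'n: "b + 1 \<le> i'" "i' < n" using n unfolding i'_def by auto
      have same: "(i - (b + 1)) div 2 = (j - (b + 1)) div 2 \<longleftrightarrow> j = i \<or> j = i'" if j: "b + 1 \<le> j" for j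
      proof -
        obtain d where "j = b + 1 + d" using le_Suc_ex[OF j] by auto
        then have "(j - (b + 1)) div 2 = a \<longleftrightarrow> j = b + 1 + 2 * a \<or> j = b + 2 + 2 * a"
          by (simp, linarith)
        also have "\<dots> \<longleftrightarrow> j \<in> {i, i'}" unfolding i'(1) by simp
        finally show ?thesis unfolding a_def[symmetric] by auto
      qed
      have "?N i = {0, i'}"
        unfolding ext using 3 i i'(2) i'n same by (auto split: if_splits)
      then have "(\<Sum>j\<in>?N i. y j) = y 0 + y i'" using i'n by simp
      then show ?thesis using v 3 i'n by (simp add: y_def)
    qed
  qed
  have "norm (complex_of_real l) \<le> spectral_radius (adj_matrix n (extremal_graph n k))"
  proof (rule norm_eigenvalue_le_spectral_radius[of n "\<lambda>i. complex_of_real (y i)"])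
    show "0 < n" using n by simp
    show "\<exists>i<n. complex_of_real (y i) \<noteq> 0" using n by (intro exI[of _ 0]) (simp add: y_def)
    fix i assume "i < n"
    have "(\<Sum>j<n. if extremal_graph n k i j then complex_of_real (y j) else 0) =
        complex_of_real (\<Sum>j<n. if extremal_graph n k i j then y j else 0)"
      by (auto intro!: sum.cong)
    also have "(\<Sum>j<n. if extremal_graph n k i j then y j else 0) = (\<Sum>j\<in>?N i. y j)"
      by (simp add: sum.inter_filter[symmetric])
    finally show "(\<Sum>j<n. if extremal_graph n k i j then complex_of_real (y j) else 0) =
        complex_of_real l * complex_of_real (y i)"
      using row[OF \<open>i < n\<close>] by simp
  qed
  then show ?thesis using bl by simp
qed

section \<open>Isomorphism with the extremal graph\<close>

text \<open>Bijections between fibres of equal size glue together, because injectivity of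
  \<open>h\<close> keeps the image fibres apart. The fibres will be the blocks, and the cliques of
  the extremal graph, without the common vertex.\<close>

lemma bij_betw_fibres:
  assumes fin: "finite A" "finite A'" and g: "g ` A \<subseteq> I" "g' ` A' \<subseteq> J" and h: "bij_betw h I J"
    and card: "\<And>i. i \<in> I \<Longrightarrow> card {x \<in> A. g x = i} = card {y \<in> A'. g' y = h i}"
  obtains f where "bij_betw f A A'" "\<And>x. x \<in> A \<Longrightarrow> g' (f x) = h (g x)"
proof -
  have "\<exists>f. bij_betw f {x \<in> A. g x = i} {y \<in> A'. g' y = h i}" if "i \<in> I" for i
    using card[OF that] fin by (intro finite_same_card_bij) auto
  then obtain F where F: "\<And>i. i \<in> I \<Longrightarrow> bij_betw (F i) {x \<in> A. g x = i} {y \<in> A'. g' y = h i}" by metis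
  define f where "f x = F (g x) x" for x
  have f: "f x \<in> A' \<and> g' (f x) = h (g x)" if "x \<in> A" for x
    using bij_betwE[OF F[of "g x"]] that g(1) by (auto simp: f_def)
  have "inj_on f A"
  proof (rule inj_onI)
    fix x y assume xy: "x \<in> A" "y \<in> A" "f x = f y"
    then have "h (g x) = h (g y)" using f by metis
    then have e: "g x = g y" using h xy g(1) by (auto simp: bij_betw_def inj_on_def)
    then have "F (g x) x = F (g x) y" using xy(3) by (simp add: f_def)
    moreover have "inj_on (F (g x)) {z \<in> A. g z = g x}" using F[of "g x"] xy(1) g(1) by (auto simp: bij_betw_def)
    ultimately show "x = y" using e xy(1,2) by (auto dest: inj_onD)
  qed
  moreover have "f ` A = A'"
  proof
    show "f ` A \<subseteq> A'" using f by blast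
    show "A' \<subseteq> f ` A"
    proof
      fix y assume y: "y \<in> A'"
      then obtain i where i: "i \<in> I" "g' y = h i" using h g(2) by (auto simp: bij_betw_def)
      then have "y \<in> F i ` {x \<in> A. g x = i}" using F[OF i(1)] y by (simp add: bij_betw_def)
      then show "y \<in> f ` A" by (auto simp: f_def)
    qed
  qed
  ultimately show ?thesis using that[of f] f by (simp add: bij_betw_def)
qed

text \<open>In both graphs distinct vertices are adjacent when one is the common vertex or their
  labels agree. Any size-preserving matching of blocks with cliques therefore yields an
  isomorphism.\<close>

lemma graph_iso_extremal_graph:
  assumes ct: "clique_tree n E" and m: "2 * k + 2 - n = b + 1" and n: "n = b + 1 + 2 * t" and b: "2 \<le> b"
    and r: "r < n" and cover: "\<And>v. v < n \<Longrightarrow> \<exists>B. is_block n E B \<and> v \<in> B"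
    and rB: "\<And>B. is_block n E B \<Longrightarrow> r \<in> B"
    and cB: "\<And>B. is_block n E B \<Longrightarrow> card (B - {r}) = 2 \<or> card (B - {r}) = b"
    and cardI: "card {B. is_block n E B} = t + 1"
    and csum: "(\<Sum>B\<in>{B. is_block n E B}. card (B - {r})) = b + 2 * t"
  shows "graph_iso n E (extremal_graph n k)"
proof -
  define I where "I = {B. is_block n E B}"
  have finI: "finite I" unfolding I_def by (rule finite_blocks)
  \<comment> \<open>Meaningful only for \<open>x \<noteq> r\<close>, where the block is unique;
    \<open>r\<close> lies in every block.\<close>
  define g where "g x = (THE B. is_block n E B \<and> x \<in> B)" for x
  define g' where "g' x = (if x < b + 1 then 0 else Suc ((x - (b + 1)) div 2))" for x
  have g_eq: "g x = B" if "is_block n E B" "x \<in> B" "x \<noteq> r" for x B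
    unfolding g_def
  proof (rule the_equality)
    show "B' = B" if B': "is_block n E B' \<and> x \<in> B'" for B'
      using block_eqI[of n E B' B x r] B' rB \<open>is_block n E B\<close> \<open>x \<in> B\<close> \<open>x \<noteq> r\<close> by blast
  qed (use that in blast)
  have g_block: "is_block n E (g x) \<and> x \<in> g x" if "x < n" "x \<noteq> r" for x
    using cover[OF that(1)] g_eq that(2) by metis
  have Bn: "B \<subseteq> {0..<n}" if "B \<in> I" for B using that by (simp add: I_def is_block_def)
  have fibre: "{x \<in> {0..<n} - {r}. g x = B} = B - {r}" if "B \<in> I" for B
    using that g_eq g_block Bn[OF that] by (auto simp: I_def)
  have edge: "E x y \<longleftrightarrow> x \<noteq> y \<and> (x = r \<or> y = r \<or> g x = g y)" if "x < n" "y < n" for x y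
  proof -
    have "(\<exists>B. is_block n E B \<and> x \<in> B \<and> y \<in> B) \<longleftrightarrow> x = r \<or> y = r \<or> g x = g y" (is "?L \<longleftrightarrow> ?R")
    proof
      show "?L \<Longrightarrow> ?R" using g_eq by metis
      show "?R \<Longrightarrow> ?L" using g_block cover that rB by metis
    qed
    then show ?thesis using clique_tree_edge_iff[OF ct, of x y] by blast
  qed
  have fibre0: "{y \<in> {1..<n}. g' y = 0} = {1..<b + 1}" using n by (auto simp: g'_def)
  have fibreS: "{y \<in> {1..<n}. g' y = Suc j} = {b + 1 + 2 * j, b + 2 + 2 * j}" if "j < t" for j
    using that n by (auto simp: g'_def split: if_splits)
  have c2: "2 \<le> card (B - {r})" if "B \<in> I" for B using cB[of B] that b by (auto simp: I_def)
  \<comment> \<open>Otherwise every size would be 2 with \<open>b \<noteq> 2\<close>, and the total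
    \<open>2 * (t + 1)\<close> would not be \<open>b + 2 * t\<close>.\<close>
  have "\<exists>B0\<in>I. card (B0 - {r}) = b"
  proof (rule ccontr)
    assume none: "\<not> (\<exists>B0\<in>I. card (B0 - {r}) = b)"
    then have *: "card (B - {r}) = 2 \<and> b \<noteq> 2" if "B \<in> I" for B
      using none cB[of B] that by (auto simp: I_def)
    then have "(\<Sum>B\<in>I. card (B - {r})) = 2 * card I" by simp
    moreover have "card I \<noteq> 0" using cardI by (simp add: I_def)
    then have "I \<noteq> {}" by auto
    ultimately show False using * csum cardI by (auto simp: I_def)
  qed
  then obtain B0 where B0: "B0 \<in> I" "card (B0 - {r}) = b" by blast
  \<comment> \<open>The other \<open>t\<close> sizes total \<open>2 * t\<close> and are each at
    least 2; this argument covers \<open>b = 2\<close> as well.\<close>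
  have two: "card (B - {r}) = 2" if "B \<in> I - {B0}" for B
  proof -
    have "(\<Sum>B\<in>I. card (B - {r})) = b + (\<Sum>B\<in>I - {B0}. card (B - {r}))"
      using sum.remove[OF finI B0(1), of "\<lambda>B. card (B - {r})"] B0(2) by simp
    then have "(\<Sum>B\<in>I - {B0}. 2) = (\<Sum>B\<in>I - {B0}. card (B - {r}))"
      using csum cardI B0(1) finI by (simp add: I_def)
    then show ?thesis using sum_mono_inv[of "\<lambda>_. 2" "I - {B0}" "\<lambda>B. card (B - {r})" B] c2 finI that by auto
  qed
  have "card (I - {B0}) = card {1..t}" using cardI B0(1) finI by (simp add: I_def)
  then obtain h0 where h0: "bij_betw h0 (I - {B0}) {1..t}"
    using finite_same_card_bij[of "I - {B0}" "{1..t}"] finI by auto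
  \<comment> \<open>\<open>B0\<close> is matched with the large clique, labelled 0, the other blocks
    with the triangles.\<close>
  define h where "h B = (if B = B0 then 0 else h0 B)" for B
  have "bij_betw h (insert B0 (I - {B0})) (insert 0 {1..t})"
  proof -
    have "bij_betw h (I - {B0}) {1..t}" using h0 by (rule bij_betw_cong[THEN iffD1, rotated]) (simp add: h_def)
    then have "bij_betw h ((I - {B0}) \<union> {B0}) ({1..t} \<union> {h B0})"
      by (subst notIn_Un_bij_betw3[symmetric]) (auto simp: h_def)
    then show ?thesis by (simp add: h_def)
  qed
  moreover have "insert B0 (I - {B0}) = I" using B0(1) by auto
  moreover have "insert 0 {1..t} = {0..t}" by auto
  ultimately have h: "bij_betw h I {0..t}" by simp
  have fibres: "card {x \<in> {0..<n} - {r}. g x = B} = card {y \<in> {1..<n}. g' y = h B}" if B: "B \<in> I" for B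
  proof (cases "B = B0")
    case True
    then show ?thesis using fibre[OF B] B0(2) fibre0 by (simp add: h_def)
  next
    case False
    then have "h B \<in> {1..t}" using h0 B by (auto simp: h_def bij_betw_def)
    then obtain j where j: "h B = Suc j" "j < t" by (cases "h B") auto
    then show ?thesis using fibre[OF B] two[of B] B False fibreS[OF j(2)] by simp
  qed
  have g_im: "g ` ({0..<n} - {r}) \<subseteq> I" using g_block by (auto simp: I_def)
  have g'_im: "g' ` {1..<n} \<subseteq> {0..t}" using n by (auto simp: g'_def)
  have finA: "finite ({0..<n} - {r})" "finite {1..<n}" by simp_all
  obtain f where f: "bij_betw f ({0..<n} - {r}) {1..<n}"
      "\<And>x. x \<in> {0..<n} - {r} \<Longrightarrow> g' (f x) = h (g x)"
    by (rule bij_betw_fibres[OF finA g_im g'_im h fibres]) (assumption, rule that)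
  define F where "F x = (if x = r then 0 else f x)" for x
  have "bij_betw F ({0..<n} - {r}) {1..<n}"
    using f(1) by (rule bij_betw_cong[THEN iffD1, rotated]) (simp add: F_def)
  then have "bij_betw F (({0..<n} - {r}) \<union> {r}) ({1..<n} \<union> {F r})"
    by (subst notIn_Un_bij_betw3[symmetric]) (auto simp: F_def)
  moreover have "({0..<n} - {r}) \<union> {r} = {0..<n}" "{1..<n} \<union> {F r} = {0..<n}"
    using r by (auto simp: F_def)
  ultimately have bijF: "bij_betw F {0..<n} {0..<n}" by simp
  have "E x y \<longleftrightarrow> extremal_graph n k (F x) (F y)" if xy: "x < n" "y < n" for x y
  proof -
    have Fn: "F x < n" "F y < n" using bij_betwE[OF bijF] xy by auto
    have F0: "F z = 0 \<longleftrightarrow> z = r" if "z < n" for z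
      using bij_betwE[OF f(1), rule_format, of z] that by (cases "z = r") (auto simp: F_def)
    have Fxy: "F x = F y \<longleftrightarrow> x = y" using bijF xy by (auto simp: bij_betw_def inj_on_def)
    have "g' (F x) = g' (F y) \<longleftrightarrow> g x = g y" if "x \<noteq> r" "y \<noteq> r"
    proof -
      have "g' (F x) = h (g x)" "g' (F y) = h (g y)" using f(2) that xy by (auto simp: F_def)
      moreover have "g x \<in> I" "g y \<in> I" using g_block that xy by (auto simp: I_def)
      ultimately show ?thesis using h by (auto simp: bij_betw_def inj_on_def)
    qed
    moreover have "extremal_graph n k (F x) (F y) \<longleftrightarrow> F x < n \<and> F y < n \<and> F x \<noteq> F y \<and>
        (F x = 0 \<or> F y = 0 \<or> g' (F x) = g' (F y))"
      unfolding g'_def by (rule extremal_graph_iff[OF m]) simp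
    ultimately show ?thesis
      unfolding edge[OF xy] using Fn Fxy F0[OF xy(1)] F0[OF xy(2)] by blast
  qed
  then show ?thesis using bijF unfolding graph_iso_def by blast
qed

theorem theorem3p3:
  fixes n k :: nat and E :: "nat \<Rightarrow> nat \<Rightarrow> bool"
  assumes "n div 2 + 1 \<le> k" and "k \<le> n - 1"
    and "E \<in> Gclass n k"
  shows "spectral_radius (adj_matrix n E) \<le> spectral_radius (adj_matrix n (extremal_graph n k))
    \<and> (spectral_radius (adj_matrix n E) = spectral_radius (adj_matrix n (extremal_graph n k))
         \<longleftrightarrow> graph_iso n E (extremal_graph n k))"
proof -
  let ?\<rho> = "\<lambda>E. spectral_radius (adj_matrix n E)"
  \<comment> \<open>\<open>b\<close> is the size of the large clique without the common vertex,
    \<open>t\<close> the number of triangles; the bounds on \<open>k\<close> exclude truncated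
    subtraction.\<close>
  define b t where "b = 2 * k + 1 - n" and "t = n - k - 1"
  have n: "n = b + 1 + 2 * t" and b: "2 \<le> b" and m: "2 * k + 2 - n = b + 1" and t: "t + 1 + k = n"
    using assms(1,2) unfolding b_def t_def by linarith+
  have ct: "clique_tree n E" and k: "zero_forcing_number n E = k"
    and c3: "\<And>B. is_block n E B \<Longrightarrow> 3 \<le> card B"
    using assms(3) by (auto simp: Gclass_def)
  \<comment> \<open>The zero forcing number of \<open>E\<close> enters only through this lower bound
    on the number of blocks.\<close>
  have card: "t + 1 \<le> card {B. is_block n E B}"
    using zero_forcing_number_ge[OF ct] k t by linarith
  obtain l :: real where l: "b \<le> l" "b / (l + 1 - b) + t * (2 / (l + 1 - 2)) = l"
    using cone_root_exists[OF b] by blast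
  \<comment> \<open>\<open>l\<close> separates the two spectral radii, so their equality forces
    \<open>?\<rho> E = l\<close>.\<close>
  have upper: "?\<rho> E \<le> l" using ct c3 card n b l by (rule clique_tree_spectral_radius_le(1))
  have lower: "l \<le> ?\<rho> (extremal_graph n k)" using m n b l by (rule spectral_radius_extremal_graph_ge)
  have "graph_iso n E (extremal_graph n k)" if "?\<rho> E = ?\<rho> (extremal_graph n k)"
  proof -
    have "?\<rho> E = l" using that upper lower by simp
    then obtain r where "r < n" "\<forall>v<n. \<exists>B. is_block n E B \<and> v \<in> B"
      "\<forall>B. is_block n E B \<longrightarrow> r \<in> B \<and> (card (B - {r}) = 2 \<or> card (B - {r}) = b)"
      "card {B. is_block n E B} = t + 1"
      "(\<Sum>B\<in>{B. is_block n E B}. card (B - {r})) = b + 2 * t"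
      using clique_tree_spectral_radius_le(2)[OF ct c3 card n b l] by blast
    then show ?thesis by (intro graph_iso_extremal_graph[OF ct m n b]) auto
  qed
  moreover have "?\<rho> (extremal_graph n k) \<le> ?\<rho> E" if "graph_iso n E (extremal_graph n k)"
    using graph_iso_spectral_radius_le[OF _ that] n by simp
  ultimately show ?thesis using upper lower by fastforce
qed

end
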